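(* Let $m\in\mathbb{N}_0$, $\vartheta\in[0,2]$ and $K\in\mathcal{K}_{m,\vartheta}$. For every $k\in\mathbb{N}$, let $u_k\in\mathcal{C}_{\vartheta,K}$ and let $f_k$ be bounded and continuous in $B_1$. Let $u\in\mathcal{C}_{\vartheta,K}$. Assume that $$Au_k\stackrel{m}{=}f_k\quad\text{in }B_1,$$ that $f_k$ converges uniformly in $B_1$ to some function $f$ as $k\to+\infty$, that $u_k$ converges to $u$ in $B_4$ as $k\to+\infty$ in the topology of $L^\infty(B_4)$ if $\vartheta=0$, of $C^\vartheta(B_4)$ if $\vartheta\in(0,1)$, of $C^{0,1}(B_4)$ if $\vartheta=1$, of $C^{1,\vartheta-1}(B_4)$ if $\vartheta\in(1,2)$, of $C^{1,1}(B_4)$ if $\vartheta=2$, that $$\lim_{k\to+\infty}\ \sup_{\substack{x\in B_1\\ R>4}}\left|\int_{B_R\setminus B_1(x)}\big((u-u_k)(x)-(u-u_k)(y)\big)K(x,y)\,dy\right|=0$$ and that $$\lim_{R\to+\infty}\ \sup_{k\in\mathbb{N}}\int_{\mathbb{R}^n\setminus B_R}|u_k(y)|\sup_{\substack{|\eta|=m\\ z\in B_1}}|\partial_x^\eta K(z,y)|\,dy=0.$$ Then $$Au\stackrel{m}{=}f\quad\text{in }B_1.$$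
   Context: $\mathbb{N}=\{1,2,\dots\}$, $\mathbb{N}_0=\{0,1,2,\dots\}$. $B_r(x)$ is the open ball in $\mathbb{R}^n$ of radius $r$ centered at $x$, $B_r:=B_r(0)$, $\Omega^c:=\mathbb{R}^n\setminus\Omega$. All functions and kernels are real-valued and Lebesgue measurable. A polynomial of degree at most $-1$ is the zero polynomial. $\chi_R$ is the characteristic function of $B_R$. For a kernel $K=K(x,y)$ the operator $A$ is $$Au(x)=\lim_{\varepsilon\searrow0}\int_{\mathbb{R}^n\setminus B_\varepsilon(x)}(u(x)-u(y))K(x,y)\,dy.$$ For $\vartheta\in[0,2]$, $\mathcal{C}_\vartheta$ is the set of $u\in L^1_{\rm loc}(\mathbb{R}^n)$ such that $u\in C(B_4)\cap L^\infty(B_4)$ if $\vartheta=0$; $u\in C^\vartheta(B_4)$ if $\vartheta\in(0,1)$; $u\in C^{0,1}(B_4)$ if $\vartheta=1$; $u\in C^{1,\vartheta-1}(B_4)$ if $\vartheta\in(1,2)$; $u\in C^{1,1}(B_4)$ if $\vartheta=2$ (Hölder spaces with finite norm on $B_4$). For $m\in\mathbb{N}_0$, $\vartheta\in[0,2]$, $\mathcal{K}_{m,\vartheta}$ is the set of kernels $K$ such that: for all $y\in B_3^c$ the map $B_1\ni x\mapsto K(x,y)$ is $C^m(B_1)$; $\int_{\mathbb{R}^n}\min\{|x-y|^\vartheta,1\}|K(x,y)|\,dy<+\infty$ for all $x\in B_1$; and, only if $\vartheta\in(1,2]$, additionally $K(x,x+z)=K(x,x-z)$ for all $x,z\in B_1$.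 Given $K\in\mathcal{K}_{m,\vartheta}$, $\mathcal{C}_{\vartheta,K}$ (which depends also on $m$) is the set of $u\in\mathcal{C}_\vartheta$ such that $$\sum_{|\alpha|\le m-1}\int_{B_R\setminus B_3}|u(y)|\,|\partial^\alpha_xK(x,y)|\,dy<+\infty\ \text{ for all }R>3,\ x\in B_1,\qquad \int_{B_3^c}|u(y)|\sup_{|\alpha|=m,\,x\in B_1}|\partial_x^\alpha K(x,y)|\,dy<+\infty.$$ Definition of $\stackrel{m}{=}$: for $K\in\mathcal{K}_{m,\vartheta}$, $u\in\mathcal{C}_{\vartheta,K}$ and $f:B_1\to\mathbb{R}$ bounded and continuous, $Au\stackrel{m}{=}f$ in $B_1$ means that there exist a family of polynomials $P_R$ ($R>3$) with $\deg P_R\le m-1$ and functions $f_R:B_1\to\mathbb{R}$ such that $A(\chi_Ru)=f_R+P_R$ pointwise in $B_1$ and $\lim_{R\to+\infty}f_R(x)=f(x)$ for every $x\in B_1$. *)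

theory Defs
  imports "HOL-Analysis.Analysis" "HOL-Probability.Essential_Supremum"
begin

text \<open>A multi-index is a function \<open>\<alpha> :: 'n \<Rightarrow> nat\<close>; the degree bound \<open>|\<alpha>| \<le> m - 1\<close> is always written
  \<open>|\<alpha>| < m\<close>, so that it is void for \<open>m = 0\<close>.\<close>

definition mi_deg :: "('n::finite \<Rightarrow> nat) \<Rightarrow> nat" where
  "mi_deg \<alpha> = (\<Sum>i\<in>UNIV. \<alpha> i)"

definition partial :: "'n::finite \<Rightarrow> (real^'n \<Rightarrow> real) \<Rightarrow> real^'n \<Rightarrow> real" where
  "partial i g x = deriv (\<lambda>t. g (x + t *\<^sub>R axis i 1)) 0"

text \<open>The index type carries no order, so an arbitrary enumeration of the coordinates is fixed. The
  order does not matter for the derivatives of order at most \<open>m\<close> of a \<open>C\<^sup>m\<close> function, the only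
  ones used below.\<close>

definition coords :: "'n::finite list" where
  "coords = (SOME is. distinct is \<and> set is = UNIV)"

definition mpartial :: "('n::finite \<Rightarrow> nat) \<Rightarrow> (real^'n \<Rightarrow> real) \<Rightarrow> real^'n \<Rightarrow> real" where
  "mpartial \<alpha> g = foldr (\<lambda>i. partial i ^^ \<alpha> i) coords g"

text \<open>\<open>C\<^sup>k(S)\<close> for open \<open>S\<close>; no bounds on the derivatives are required.\<close>

primrec Ck_on :: "nat \<Rightarrow> (real^'n::finite) set \<Rightarrow> (real^'n \<Rightarrow> real) \<Rightarrow> bool" where
  "Ck_on 0 S g \<longleftrightarrow> continuous_on S g"
| "Ck_on (Suc k) S g \<longleftrightarrow> (\<forall>x\<in>S. g differentiable (at x)) \<and> (\<forall>i. Ck_on k S (partial i g))"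

definition poly_deg_less :: "nat \<Rightarrow> (real^'n::finite \<Rightarrow> real) \<Rightarrow> bool" where
  "poly_deg_less m p \<longleftrightarrow>
     (\<exists>c. \<forall>x. p x = (\<Sum>\<alpha> | mi_deg \<alpha> < m. c \<alpha> * (\<Prod>i\<in>UNIV. (x $ i) ^ \<alpha> i)))"

text \<open>Norms and suprema take values in \<open>ennreal\<close>, so that an infinite value is really infinite.\<close>

definition sup_norm :: "'a set \<Rightarrow> ('a \<Rightarrow> real) \<Rightarrow> ennreal" where
  "sup_norm S g = (SUP x\<in>S. ennreal \<bar>g x\<bar>)"

definition holder_seminorm :: "real \<Rightarrow> (real^'n::finite) set \<Rightarrow> (real^'n \<Rightarrow> real) \<Rightarrow> ennreal" where
  "holder_seminorm \<gamma> S g =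
     (SUP x\<in>S. SUP y\<in>S - {x}. ennreal (\<bar>g x - g y\<bar> / norm (x - y) powr \<gamma>))"

definition holder0_norm :: "real \<Rightarrow> (real^'n::finite) set \<Rightarrow> (real^'n \<Rightarrow> real) \<Rightarrow> ennreal" where
  "holder0_norm \<gamma> S g = sup_norm S g + holder_seminorm \<gamma> S g"

definition holder1_norm :: "real \<Rightarrow> (real^'n::finite) set \<Rightarrow> (real^'n \<Rightarrow> real) \<Rightarrow> ennreal" where
  "holder1_norm \<gamma> S g = sup_norm S g + (\<Sum>i\<in>UNIV. holder0_norm \<gamma> S (partial i g))"

definition Linf_norm :: "(real^'n::finite) set \<Rightarrow> (real^'n \<Rightarrow> real) \<Rightarrow> ennreal" where
  "Linf_norm S g = esssup (lebesgue_on S) (\<lambda>x. ennreal \<bar>g x\<bar>)"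

text \<open>The norm of \<open>L\<^sup>\<infinity>(B\<^sub>4)\<close> for \<open>\<theta> = 0\<close>, of \<open>C\<^sup>0\<^sup>,\<^sup>\<theta>(B\<^sub>4)\<close> for \<open>0 < \<theta> \<le> 1\<close> and of \<open>C\<^sup>1\<^sup>,\<^sup>\<theta>\<^sup>-\<^sup>1(B\<^sub>4)\<close> for
  \<open>1 < \<theta> \<le> 2\<close>.\<close>

definition theta_norm :: "real \<Rightarrow> (real^'n::finite \<Rightarrow> real) \<Rightarrow> ennreal" where
  "theta_norm \<theta> g =
     (if \<theta> = 0 then Linf_norm (ball 0 4) g
      else if \<theta> \<le> 1 then holder0_norm \<theta> (ball 0 4) g
      else holder1_norm (\<theta> - 1) (ball 0 4) g)"

definition L1_loc :: "(real^'n::finite \<Rightarrow> real) set" where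
  "L1_loc = {u. u \<in> borel_measurable lebesgue \<and>
                (\<forall>S. compact S \<longrightarrow> set_integrable lebesgue S u)}"

definition C_theta :: "real \<Rightarrow> (real^'n::finite \<Rightarrow> real) set" where
  "C_theta \<theta> =
     {u \<in> L1_loc.
        (\<theta> \<le> 1 \<longrightarrow> Ck_on 0 (ball 0 4) u) \<and>
        (1 < \<theta> \<longrightarrow> Ck_on 1 (ball 0 4) u) \<and>
        theta_norm \<theta> u < \<infinity>}"

text \<open>Joint Lebesgue measurability of the kernel does not give measurability of every slice
  \<open>K(x, \<cdot>)\<close>, which the integrals with \<open>x\<close> in \<open>B\<^sub>1\<close> presuppose; both are required. The
  convention \<open>0 powr 0 = 0\<close> only affects the single point \<open>y = x\<close>.\<close>

definition K_class :: "nat \<Rightarrow> real \<Rightarrow> (real^'n::finite \<Rightarrow> real^'n \<Rightarrow> real) set" where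
  "K_class m \<theta> =
     {K. (\<lambda>(x, y). K x y) \<in> borel_measurable lebesgue \<and>
         (\<forall>x\<in>ball 0 1. K x \<in> borel_measurable lebesgue) \<and>
         (\<forall>y\<in>- ball 0 3. Ck_on m (ball 0 1) (\<lambda>x. K x y)) \<and>
         (\<forall>x\<in>ball 0 1.
            (\<integral>\<^sup>+y. ennreal (min (norm (x - y) powr \<theta>) 1 * \<bar>K x y\<bar>) \<partial>lebesgue) < \<infinity>) \<and>
         (1 < \<theta> \<longrightarrow> (\<forall>x\<in>ball 0 1. \<forall>z\<in>ball 0 1. K x (x + z) = K x (x - z)))}"

definition sup_partials ::
  "nat \<Rightarrow> (real^'n::finite \<Rightarrow> real^'n \<Rightarrow> real) \<Rightarrow> real^'n \<Rightarrow> ennreal" where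
  "sup_partials m K y =
     (SUP \<alpha>\<in>{\<alpha>. mi_deg \<alpha> = m}. SUP x\<in>ball 0 1. ennreal \<bar>mpartial \<alpha> (\<lambda>x. K x y) x\<bar>)"

definition C_theta_K ::
  "nat \<Rightarrow> real \<Rightarrow> (real^'n::finite \<Rightarrow> real^'n \<Rightarrow> real) \<Rightarrow> (real^'n \<Rightarrow> real) set" where
  "C_theta_K m \<theta> K =
     {u \<in> C_theta \<theta>.
        (\<forall>R>3. \<forall>x\<in>ball 0 1.
           (\<Sum>\<alpha> | mi_deg \<alpha> < m.
              \<integral>\<^sup>+y\<in>ball 0 R - ball 0 3. ennreal (\<bar>u y\<bar> * \<bar>mpartial \<alpha> (\<lambda>x. K x y) x\<bar>) \<partial>lebesgue) < \<infinity>) \<and>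
        (\<integral>\<^sup>+y\<in>- ball 0 3. ennreal \<bar>u y\<bar> * sup_partials m K y \<partial>lebesgue) < \<infinity>}"

text \<open>\<open>has_A_value K u x l\<close> says that \<open>Au(x)\<close> exists as a principal value and equals \<open>l\<close>. The
  integrability clause excludes the default value \<open>0\<close> of the Bochner integral.\<close>

definition has_A_value ::
  "(real^'n::finite \<Rightarrow> real^'n \<Rightarrow> real) \<Rightarrow> (real^'n \<Rightarrow> real) \<Rightarrow> real^'n \<Rightarrow> real \<Rightarrow> bool" where
  "has_A_value K u x l \<longleftrightarrow>
     (\<forall>\<epsilon>>0. set_integrable lebesgue (- ball x \<epsilon>) (\<lambda>y. (u x - u y) * K x y)) \<and>
     ((\<lambda>\<epsilon>. LINT y:(- ball x \<epsilon>)|lebesgue. (u x - u y) * K x y) \<longlongrightarrow> l) (at_right 0)"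

definition cutoff :: "real \<Rightarrow> (real^'n::finite \<Rightarrow> real) \<Rightarrow> real^'n \<Rightarrow> real" where
  "cutoff R u y = indicator (ball 0 R) y * u y"

text \<open>\<open>A_eq_mod m K u f\<close> is \<open>Au = f\<close> in \<open>B\<^sub>1\<close> modulo polynomials of degree at most \<open>m - 1\<close>. The
  relation is only meaningful for bounded continuous \<open>f\<close>, which is therefore part of it.\<close>

definition A_eq_mod ::
  "nat \<Rightarrow> (real^'n::finite \<Rightarrow> real^'n \<Rightarrow> real) \<Rightarrow> (real^'n \<Rightarrow> real) \<Rightarrow> (real^'n \<Rightarrow> real) \<Rightarrow> bool" where
  "A_eq_mod m K u f \<longleftrightarrow>
     continuous_on (ball 0 1) f \<and> bounded (f ` ball 0 1) \<and>
     (\<exists>(P :: real \<Rightarrow> real^'n \<Rightarrow> real) (F :: real \<Rightarrow> real^'n \<Rightarrow> real).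
        (\<forall>R>3. poly_deg_less m (P R) \<and> F R \<in> borel_measurable (lebesgue_on (ball 0 1)) \<and>
               (\<forall>x\<in>ball 0 1. has_A_value K (cutoff R u) x (F R x + P R x))) \<and>
        (\<forall>x\<in>ball 0 1. ((\<lambda>R. F R x) \<longlongrightarrow> f x) at_top))"

end

theory Submission
  imports Defs
begin

text \<open>Choose finitely many nodes in \<open>B\<^sub>1\<close> that are unisolvent for the polynomials of degree less than
  \<open>m\<close>, and let \<open>\<pi>\<close> be the interpolation projection at these nodes. Then \<open>A(\<chi>\<^sub>R u)\<close> converges to \<open>f\<close>
  modulo polynomials iff \<open>(1 - \<pi>) A(\<chi>\<^sub>R u) \<longlongrightarrow> (1 - \<pi>) f\<close> pointwise, an ordinary limit. At each point
  \<open>A(\<chi>\<^sub>R u\<^sub>k)\<close> converges to \<open>A(\<chi>\<^sub>R u)\<close> uniformly in \<open>R\<close>: the part of the principal value near \<open>x\<close> and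
  the part outside \<open>B\<^sub>R\<close>, where the truncated function vanishes, are bounded by the norm of
  \<open>u\<^sub>k - u\<close>, and the part over \<open>B\<^sub>R - B\<^sub>1(x)\<close> is controlled by hypothesis for \<open>R > 4\<close> and by the norm for
  \<open>R \<le> 4\<close>. Hence the limits in \<open>k\<close> and \<open>R\<close> may be exchanged.\<close>

section \<open>Interpolation of polynomials of degree less than m at finitely many nodes\<close>

text \<open>Induction on the index set. Let r be the error of interpolating the new
  \<open>b j\<close> at the nodes found so far. If r vanishes on \<open>S\<close>, these nodes
  suffice. Otherwise a point z of \<open>S\<close> with r z \<noteq> 0 becomes a node, and r, which
  vanishes at the old nodes, is used to build the new cardinal functions. The relation
  \<open>L a a' = of_bool (a = a')\<close> is carried along because it makes r vanish at the old
  nodes.\<close>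

lemma interpolation_nodes:
  fixes b :: "'i \<Rightarrow> 'a \<Rightarrow> real" and V :: "('a \<Rightarrow> real) \<Rightarrow> bool"
  assumes "finite I"
    and V_add: "\<And>f g c. V f \<Longrightarrow> V g \<Longrightarrow> V (\<lambda>x. f x + c * g x)"
    and "\<And>i. i \<in> I \<Longrightarrow> V (b i)"
  shows "\<exists>X L. finite X \<and> X \<subseteq> S \<and> (\<forall>a\<in>X. V (L a)) \<and>
     (\<forall>a\<in>X. \<forall>a'\<in>X. L a a' = of_bool (a = a')) \<and>
     (\<forall>i\<in>I. \<forall>x\<in>S. b i x = (\<Sum>a\<in>X. b i a * L a x))"
  using assms(1,3)
proof (induction I)
  case empty
  show ?case by (rule exI[of _ "{}"]) auto
next
  case (insert j I)
  then obtain X L where fin: "finite X" and XS: "X \<subseteq> S" and VL: "\<And>a. a \<in> X \<Longrightarrow> V (L a)"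
    and delta: "\<And>a a'. a \<in> X \<Longrightarrow> a' \<in> X \<Longrightarrow> L a a' = of_bool (a = a')"
    and rep: "\<And>i x. i \<in> I \<Longrightarrow> x \<in> S \<Longrightarrow> b i x = (\<Sum>a\<in>X. b i a * L a x)"
    by (metis insertCI)
  define r where "r x = b j x - (\<Sum>a\<in>X. b j a * L a x)" for x
  have rX: "r a = 0" if "a \<in> X" for a
    using that fin by (simp add: r_def delta of_bool_def if_distrib sum.delta cong: if_cong)
  \<comment> \<open>Closure of \<open>V\<close> adds one multiple at a time, so membership of r is
    built up over subsets of the node set.\<close>
  have "V (\<lambda>x. b j x - (\<Sum>a\<in>Y. b j a * L a x))" if "finite Y" "Y \<subseteq> X" for Y
    using that
  proof (induction Y)
    case empty
    then show ?case using insert.prems by simp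
  next
    case (insert a Y)
    then have "V (\<lambda>x. (b j x - (\<Sum>a\<in>Y. b j a * L a x)) + (- b j a) * L a x)"
      by (intro V_add VL) auto
    with insert show ?case by (simp add: algebra_simps)
  qed
  then have Vr: "V r" using fin by (simp add: r_def[abs_def])
  show ?case
  proof (cases "\<forall>x\<in>S. r x = 0")
    case True
    then have "b j x = (\<Sum>a\<in>X. b j a * L a x)" if "x \<in> S" for x
      using that by (simp add: r_def)
    then show ?thesis
      by (intro exI[of _ X] exI[of _ L]) (use fin XS VL delta rep in auto)
  next
    case False
    then obtain z where z: "z \<in> S" "r z \<noteq> 0" by blast
    then have zX: "z \<notin> X" using rX by blast
    \<comment> \<open>Normalising r gives the cardinal function of z. Subtracting a multiple of r
      makes the old ones vanish at z and leaves their values on \<open>X\<close> unchanged.\<close>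
    define L' where "L' a x = (if a = z then r x / r z else L a x - L a z / r z * r x)" for a x
    have L'z: "L' z x = r x / r z" for x by (simp add: L'_def)
    have L'a: "L' a x = L a x - L a z / r z * r x" if "a \<in> X" for a x
      using that zX by (auto simp: L'_def)
    have VL': "V (L' a)" if "a \<in> insert z X" for a
    proof (cases "a = z")
      case True
      \<comment> \<open>The closure assumption has the form f + c g, so r / r z is written as r plus
        a multiple of r.\<close>
      have "V (\<lambda>x. r x + (1 / r z - 1) * r x)" by (intro V_add Vr)
      also have "(\<lambda>x. r x + (1 / r z - 1) * r x) = L' a"
        using True by (auto simp: L'z algebra_simps)
      finally show ?thesis .
    next
      case False
      then have "V (\<lambda>x. L a x + (- L a z / r z) * r x)" using that by (intro V_add Vr VL) auto
      also have "(\<lambda>x. L a x + (- L a z / r z) * r x) = L' a"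
        using False that by (auto simp: L'a)
      finally show ?thesis .
    qed
    \<comment> \<open>The new interpolant is the old one plus the multiple of r that removes the
      error at z. For \<open>b j\<close> that error is r z, so exactly r is added; for the earlier
      functions it is 0.\<close>
    have expand: "(\<Sum>a\<in>insert z X. g a * L' a x) =
      (\<Sum>a\<in>X. g a * L a x) + (g z - (\<Sum>a\<in>X. g a * L a z)) / r z * r x" for g x
    proof -
      have "(\<Sum>a\<in>insert z X. g a * L' a x) = g z * (r x / r z) + (\<Sum>a\<in>X. g a * L' a x)"
        using fin zX by (simp add: L'z)
      also have "(\<Sum>a\<in>X. g a * L' a x) = (\<Sum>a\<in>X. g a * L a x) - (\<Sum>a\<in>X. g a * L a z) / r z * r x"
        by (simp add: L'a algebra_simps sum_subtractf sum_distrib_left sum_divide_distrib)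
      finally show ?thesis by (simp add: algebra_simps diff_divide_distrib)
    qed
    have "b i x = (\<Sum>a\<in>insert z X. b i a * L' a x)" if "i \<in> insert j I" "x \<in> S" for i x
    proof (cases "i = j")
      case True
      then show ?thesis unfolding expand using z(2) by (simp add: r_def)
    next
      case False
      then show ?thesis unfolding expand using that rep[of i] z by simp
    qed
    moreover have "L' a a' = of_bool (a = a')" if "a \<in> insert z X" "a' \<in> insert z X" for a a'
      using that z zX rX delta by (auto simp: L'z L'a)
    ultimately show ?thesis
      by (intro exI[of _ "insert z X"] exI[of _ L']) (use fin XS VL' z in simp_all)
  qed
qed

lemma finite_mi_deg_less: "finite {\<alpha> :: 'n::finite \<Rightarrow> nat. mi_deg \<alpha> < m}"
proof (rule finite_subset)
  have "\<alpha> i \<le> mi_deg \<alpha>" for \<alpha> :: "'n \<Rightarrow> nat" and i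
    unfolding mi_deg_def by (rule member_le_sum) auto
  then show "{\<alpha> :: 'n \<Rightarrow> nat. mi_deg \<alpha> < m} \<subseteq>
      {\<alpha>. \<forall>i. (i \<in> UNIV \<longrightarrow> \<alpha> i \<in> {..<m}) \<and> (i \<notin> UNIV \<longrightarrow> \<alpha> i = 0)}"
    by (auto intro: le_less_trans)
qed (rule finite_set_of_finite_funs; simp)

lemma poly_deg_less_add_mult:
  assumes "poly_deg_less m p" "poly_deg_less m q"
  shows "poly_deg_less m (\<lambda>x. p x + c * q x)"
proof -
  obtain a b where "\<And>x. p x = (\<Sum>\<alpha> | mi_deg \<alpha> < m. a \<alpha> * (\<Prod>i\<in>UNIV. (x $ i) ^ \<alpha> i))"
    "\<And>x. q x = (\<Sum>\<alpha> | mi_deg \<alpha> < m. b \<alpha> * (\<Prod>i\<in>UNIV. (x $ i) ^ \<alpha> i))"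
    using assms unfolding poly_deg_less_def by blast
  then have "p x + c * q x = (\<Sum>\<alpha> | mi_deg \<alpha> < m. (a \<alpha> + c * b \<alpha>) * (\<Prod>i\<in>UNIV. (x $ i) ^ \<alpha> i))" for x
    by (simp add: sum_distrib_left algebra_simps sum.distrib)
  then show ?thesis
    unfolding poly_deg_less_def by (intro exI[of _ "\<lambda>\<alpha>. a \<alpha> + c * b \<alpha>"] allI)
qed

lemma poly_deg_less_sum:
  assumes "finite X" "\<And>a. a \<in> X \<Longrightarrow> poly_deg_less m (L a)"
  shows "poly_deg_less m (\<lambda>x. \<Sum>a\<in>X. c a * L a x)"
  using assms
proof (induction X)
  case empty
  show ?case unfolding poly_deg_less_def by (intro exI[of _ "\<lambda>_. 0"]) simp
next
  case (insert a X)
  then have "poly_deg_less m (\<lambda>x. (\<Sum>a\<in>X. c a * L a x) + c a * L a x)"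
    by (intro poly_deg_less_add_mult) auto
  with insert show ?case by (simp add: add.commute)
qed

lemma poly_deg_less_monomial:
  fixes \<beta> :: "'n::finite \<Rightarrow> nat"
  assumes "mi_deg \<beta> < m"
  shows "poly_deg_less m (\<lambda>x. \<Prod>i\<in>UNIV. (x $ i) ^ \<beta> i)"
proof -
  have "(\<Prod>i\<in>UNIV. (x $ i) ^ \<beta> i) =
      (\<Sum>\<alpha> | mi_deg \<alpha> < m. of_bool (\<alpha> = \<beta>) * (\<Prod>i\<in>UNIV. (x $ i) ^ \<alpha> i))" for x :: "real^'n"
    by (subst sum.mono_neutral_right[of _ "{\<beta>}"]) (use assms finite_mi_deg_less in auto)
  then show ?thesis
    unfolding poly_deg_less_def by (intro exI[of _ "\<lambda>\<alpha>. of_bool (\<alpha> = \<beta>)"] allI)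
qed

lemma poly_deg_less_measurable:
  assumes "poly_deg_less m p"
  shows "p \<in> borel_measurable (lebesgue_on S)"
proof -
  obtain c where "\<And>x. p x = (\<Sum>\<alpha> | mi_deg \<alpha> < m. c \<alpha> * (\<Prod>i\<in>UNIV. (x $ i) ^ \<alpha> i))"
    using assms unfolding poly_deg_less_def by blast
  then have "p = (\<lambda>x. \<Sum>\<alpha> | mi_deg \<alpha> < m. c \<alpha> * (\<Prod>i\<in>UNIV. (x $ i) ^ \<alpha> i))" by blast
  moreover have "continuous_on UNIV \<dots>" by (intro continuous_intros)
  ultimately have "p \<in> borel_measurable borel" by (simp add: borel_measurable_continuous_onI)
  then show ?thesis by (intro measurable_restrict_space1 measurable_completion) simp
qed

text \<open>Reproduction of the monomials extends to all polynomials by linearity. Since a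
  polynomial on \<open>S\<close> is thus recovered from finitely many values, convergence modulo
  polynomials can be tested by an ordinary limit.\<close>

lemma poly_deg_less_interpolation:
  fixes S :: "(real^'n::finite) set"
  obtains X L where "finite X" "X \<subseteq> S" "\<And>a. a \<in> X \<Longrightarrow> poly_deg_less m (L a)"
    "\<And>p x. poly_deg_less m p \<Longrightarrow> x \<in> S \<Longrightarrow> p x = (\<Sum>a\<in>X. p a * L a x)"
proof -
  let ?b = "\<lambda>(\<alpha> :: 'n \<Rightarrow> nat) (x :: real^'n). \<Prod>i\<in>UNIV. (x $ i) ^ \<alpha> i"
  obtain X L where X: "finite X" "X \<subseteq> S" "\<And>a. a \<in> X \<Longrightarrow> poly_deg_less m (L a)"
    and rep: "\<And>\<alpha> x. mi_deg \<alpha> < m \<Longrightarrow> x \<in> S \<Longrightarrow> ?b \<alpha> x = (\<Sum>a\<in>X. ?b \<alpha> a * L a x)"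
    using interpolation_nodes[of "{\<alpha>. mi_deg \<alpha> < m}" "poly_deg_less m" ?b S,
        OF finite_mi_deg_less poly_deg_less_add_mult] poly_deg_less_monomial
    by (smt (verit) mem_Collect_eq)
  have "p x = (\<Sum>a\<in>X. p a * L a x)" if p: "poly_deg_less m p" and x: "x \<in> S" for p x
  proof -
    obtain c where c: "\<And>x. p x = (\<Sum>\<alpha> | mi_deg \<alpha> < m. c \<alpha> * ?b \<alpha> x)"
      using p unfolding poly_deg_less_def by blast
    have "p x = (\<Sum>\<alpha> | mi_deg \<alpha> < m. c \<alpha> * (\<Sum>a\<in>X. ?b \<alpha> a * L a x))"
      unfolding c by (rule sum.cong) (simp_all flip: rep[OF _ x])
    also have "\<dots> = (\<Sum>a\<in>X. \<Sum>\<alpha> | mi_deg \<alpha> < m. c \<alpha> * (?b \<alpha> a * L a x))"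
      unfolding sum_distrib_left by (rule sum.swap)
    also have "\<dots> = (\<Sum>a\<in>X. p a * L a x)"
      unfolding c by (simp add: sum_distrib_right mult.assoc)
    finally show ?thesis .
  qed
  with X that show thesis by blast
qed

section \<open>Pointwise and first-order bounds from the norm on \<open>B\<^sub>4\<close>\<close>

lemma sup_norm_leD:
  assumes "sup_norm S g \<le> ennreal N" "0 \<le> N" "x \<in> S"
  shows "\<bar>g x\<bar> \<le> N"
proof -
  have "ennreal \<bar>g x\<bar> \<le> ennreal N"
    using order_trans[OF SUP_upper assms(1)[unfolded sup_norm_def]] assms(3) .
  with assms show ?thesis by simp
qed

lemma holder_seminorm_leD:
  assumes "holder_seminorm \<gamma> S g \<le> ennreal N" "0 \<le> N" "x \<in> S" "y \<in> S"
  shows "\<bar>g x - g y\<bar> \<le> N * norm (x - y) powr \<gamma>"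
proof (cases "x = y")
  case False
  have "ennreal (\<bar>g x - g y\<bar> / norm (x - y) powr \<gamma>) \<le> holder_seminorm \<gamma> S g"
    unfolding holder_seminorm_def using False assms by (intro SUP_upper2[of x] SUP_upper2[of y]) auto
  also note assms(1)
  finally show ?thesis using False assms by (simp add: divide_le_eq)
qed (use assms in simp)

lemma holder0_norm_leD:
  assumes "holder0_norm \<gamma> S g \<le> ennreal N"
  shows "sup_norm S g \<le> ennreal N" "holder_seminorm \<gamma> S g \<le> ennreal N"
proof -
  have "sup_norm S g \<le> holder0_norm \<gamma> S g" "holder_seminorm \<gamma> S g \<le> holder0_norm \<gamma> S g"
    by (simp_all add: holder0_norm_def add_increasing add_increasing2)
  then show "sup_norm S g \<le> ennreal N" "holder_seminorm \<gamma> S g \<le> ennreal N"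
    using assms order_trans by blast+
qed

lemma holder1_norm_leD:
  assumes "holder1_norm \<gamma> S g \<le> ennreal N"
  shows "sup_norm S g \<le> ennreal N" "holder0_norm \<gamma> S (partial i g) \<le> ennreal N"
proof -
  let ?s = "\<Sum>i\<in>UNIV. holder0_norm \<gamma> S (partial i g)"
  have "sup_norm S g \<le> sup_norm S g + ?s" "?s \<le> sup_norm S g + ?s"
    by (simp_all add: add_increasing add_increasing2)
  moreover have "holder0_norm \<gamma> S (partial i g) \<le> ?s"
    by (rule member_le_sum) auto
  ultimately show "sup_norm S g \<le> ennreal N" "holder0_norm \<gamma> S (partial i g) \<le> ennreal N"
    using order_trans[OF _ assms[unfolded holder1_norm_def]] by (meson order_trans)+
qed

text \<open>If the bound failed at one point, continuity would make it fail on a nonempty open set,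
  which is not a null set.\<close>

lemma Linf_norm_leD:
  assumes "Linf_norm S g \<le> ennreal N" "0 \<le> N" "open S" "continuous_on S g" "x \<in> S"
  shows "\<bar>g x\<bar> \<le> N"
proof -
  have "AE x in lebesgue_on S. ennreal \<bar>g x\<bar> \<le> ennreal N"
    using esssup_AE[of "\<lambda>x. ennreal \<bar>g x\<bar>" "lebesgue_on S"]
    by (rule eventually_mono) (use assms(1) in \<open>auto simp: Linf_norm_def\<close>)
  then have "AE x \<in> S in lebesgue. \<bar>g x\<bar> \<le> N"
    using assms by (subst (asm) AE_restrict_space_iff) auto
  then have AE: "AE y \<in> S in lebesgue. (y \<in> S \<longrightarrow> \<bar>g y\<bar> \<le> N)" by simp
  show ?thesis
  proof (rule ccontr)
    assume "\<not> \<bar>g x\<bar> \<le> N"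
    define U where "U = S \<inter> (\<lambda>y. \<bar>g y\<bar>) -` {N<..}"
    have "open U" unfolding U_def
      using assms by (intro continuous_open_preimage continuous_intros) auto
    moreover have "AE y \<in> U in lebesgue. y \<in> {}"
      using AE by eventually_elim (auto simp: U_def)
    moreover have "x \<in> U" using \<open>\<not> \<bar>g x\<bar> \<le> N\<close> assms by (simp add: U_def)
    ultimately show False using mem_closed_if_AE_lebesgue_open[of U "{}" x] by simp
  qed
qed

lemma theta_norm_leD:
  assumes "theta_norm \<theta> g \<le> ennreal N" "0 \<le> N"
    and "continuous_on (ball 0 4) g" "x \<in> ball 0 4"
  shows "\<bar>g x\<bar> \<le> N"
proof -
  consider "\<theta> = 0" | "\<theta> \<noteq> 0" "\<theta> \<le> 1" | "\<not> \<theta> \<le> 1" "\<theta> \<noteq> 0" by linarith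
  then show ?thesis
  proof cases
    case 1
    with assms show ?thesis by (intro Linf_norm_leD) (auto simp: theta_norm_def)
  next
    case 2
    with assms(1) have "sup_norm (ball 0 4) g \<le> ennreal N"
      by (intro holder0_norm_leD(1)) (simp add: theta_norm_def)
    with assms show ?thesis by (intro sup_norm_leD)
  next
    case 3
    with assms(1) have "sup_norm (ball 0 4) g \<le> ennreal N"
      by (intro holder1_norm_leD(1)) (simp add: theta_norm_def)
    with assms show ?thesis by (intro sup_norm_leD)
  qed
qed

text \<open>\<open>partial\<close> rests on \<open>deriv\<close>, which is meaningful only where a
  derivative exists; differentiability identifies it with the total derivative applied to a basis
  vector.\<close>

lemma has_derivative_partial:
  assumes "g differentiable (at x)"
  shows "(g has_derivative (\<lambda>h. \<Sum>i\<in>UNIV. partial i g x * h $ i)) (at x)"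
proof -
  from assms obtain D where D: "(g has_derivative D) (at x)"
    by (auto simp: differentiable_def)
  interpret D: linear D using D by (rule has_derivative_linear)
  have "partial i g x = D (axis i 1)" for i
  proof -
    have "((\<lambda>t. g (x + t *\<^sub>R axis i 1)) has_derivative (\<lambda>t. D (t *\<^sub>R axis i 1))) (at 0)"
      by (rule has_derivative_compose[of "\<lambda>t. x + t *\<^sub>R axis i 1" "\<lambda>t. t *\<^sub>R axis i 1" 0 UNIV g D])
        (use D in \<open>auto intro!: derivative_eq_intros\<close>)
    then have "((\<lambda>t. g (x + t *\<^sub>R axis i 1)) has_field_derivative D (axis i 1)) (at 0)"
      by (simp add: D.scale has_field_derivative_def mult_commute_abs)
    then show ?thesis unfolding partial_def by (rule DERIV_imp_deriv)
  qed
  moreover have "D h = (\<Sum>i\<in>UNIV. D (axis i 1) * h $ i)" for h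
  proof -
    have "D h = D (\<Sum>i\<in>UNIV. h $ i *s axis i 1)" by (simp only: basis_expansion)
    then show ?thesis by (simp add: D.sum D.scale mult.commute scalar_mult_eq_scaleR)
  qed
  then have "D = (\<lambda>h. \<Sum>i\<in>UNIV. D (axis i 1) * h $ i)" by blast
  ultimately show ?thesis using D by simp
qed

text \<open>For \<open>\<theta> > 1\<close> the first-order term \<open>p\<close> disappears from the principal value by the symmetry of
  the kernel; for \<open>\<theta> \<le> 1\<close> no symmetry is assumed, hence \<open>p = 0\<close>.\<close>

lemma theta_norm_taylor:
  fixes g :: "real^'n::finite \<Rightarrow> real" and N :: real
  assumes "0 \<le> \<theta>" "\<theta> \<le> 2" and N: "theta_norm \<theta> g \<le> ennreal N" "0 \<le> N"
    and C0: "continuous_on (ball 0 4) g" and C1: "\<And>y. 1 < \<theta> \<Longrightarrow> y \<in> ball 0 4 \<Longrightarrow> g differentiable (at y)"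
    and S: "x \<in> ball 0 4"
  obtains p where "p = 0 \<or> 1 < \<theta>"
    "\<And>y. y \<in> ball 0 4 \<Longrightarrow>
       \<bar>g x - g y + p \<bullet> (y - x)\<bar> \<le> (2 + CARD('n)) * N * norm (x - y) powr \<theta>"
proof -
  \<comment> \<open>The factor \<open>2 + CARD('n)\<close> serves all cases at once: 2 comes from
    bounding g x and g y separately for \<theta> = 0, a factor 1 suffices for 0 < \<theta> \<le> 1,
    and \<open>CARD('n)\<close> counts the gradient components for 1 < \<theta>.\<close>
  consider "\<theta> = 0" | "0 < \<theta>" "\<theta> \<le> 1" | "1 < \<theta>" using assms(1) by linarith
  then show thesis
  proof cases
    case 1
    show thesis
    proof (rule that[of 0])
      fix y :: "real^'n" assume y: "y \<in> ball 0 4"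
      have "\<bar>g x\<bar> \<le> N" "\<bar>g y\<bar> \<le> N" using theta_norm_leD[OF N C0] y S by auto
      then have "\<bar>g x - g y\<bar> \<le> 2 * N" by linarith
      also have "\<dots> \<le> (2 + CARD('n)) * N" using N by (simp add: distrib_right)
      \<comment> \<open>At y = x both sides are 0, because \<open>0 powr 0\<close> is 0.\<close>
      finally show "\<bar>g x - g y + 0 \<bullet> (y - x)\<bar> \<le> (2 + CARD('n)) * N * norm (x - y) powr \<theta>"
        using 1 N by (cases "x = y") auto
    qed simp
  next
    case 2
    show thesis
    proof (rule that[of 0])
      fix y :: "real^'n" assume y: "y \<in> ball 0 4"
      have "\<bar>g x - g y\<bar> \<le> N * norm (x - y) powr \<theta>"
        using 2 N y S holder0_norm_leD(2) by (intro holder_seminorm_leD[of _ "ball 0 4"]) (auto simp: theta_norm_def)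
      also have "\<dots> \<le> (2 + CARD('n)) * N * norm (x - y) powr \<theta>"
        using N by (intro mult_right_mono) (auto simp: distrib_right)
      finally show "\<bar>g x - g y + 0 \<bullet> (y - x)\<bar> \<le> (2 + CARD('n)) * N * norm (x - y) powr \<theta>"
        by simp
    qed simp
  next
    case 3
    \<comment> \<open>Here p is the gradient of g at x. The mean value theorem on the segment from x
      to y turns the remainder into the inner product of z = y - x with the difference of the
      gradients at x and at x + t z, and each component of that difference is controlled by the
      Hoelder seminorm of exponent \<theta> - 1.\<close>
    show thesis
    proof (rule that[of "\<chi> i. partial i g x"])
      fix y :: "real^'n" assume y: "y \<in> ball 0 4"
      define z where "z = y - x"
      have seg: "x + t *\<^sub>R z \<in> ball 0 4" if "0 \<le> t" "t \<le> 1" for t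
      proof -
        have "(1 - t) *\<^sub>R x + t *\<^sub>R y \<in> ball 0 4"
          using convexD_alt[OF convex_ball S y] that by simp
        then show ?thesis by (simp add: z_def algebra_simps)
      qed
      have der: "((\<lambda>t. g (x + t *\<^sub>R z)) has_derivative
          (\<lambda>s. \<Sum>i\<in>UNIV. partial i g (x + t *\<^sub>R z) * (s *\<^sub>R z) $ i)) (at t within {0..1})"
        if "0 \<le> t" "t \<le> 1" for t
        by (rule has_derivative_compose[of "\<lambda>t. x + t *\<^sub>R z" "\<lambda>s. s *\<^sub>R z" t "{0..1}" g])
          (use has_derivative_partial[OF C1[OF 3 seg[OF that]]] in \<open>auto intro!: derivative_eq_intros\<close>)
      obtain t where t: "0 < t" "t < 1"
        and mvt: "g (x + 1 *\<^sub>R z) - g (x + 0 *\<^sub>R z) =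
          (\<Sum>i\<in>UNIV. partial i g (x + t *\<^sub>R z) * ((1 - 0) *\<^sub>R z) $ i)"
        using mvt_simple[OF zero_less_one, OF der] by auto
      have "\<bar>g x - g y + (\<chi> i. partial i g x) \<bullet> (y - x)\<bar> =
          \<bar>\<Sum>i\<in>UNIV. (partial i g x - partial i g (x + t *\<^sub>R z)) * z $ i\<bar>"
        using mvt by (simp add: z_def inner_vec_def left_diff_distrib sum_subtractf)
      also have "\<dots> \<le> (\<Sum>i\<in>(UNIV :: 'n set). N * norm z powr (\<theta> - 1) * norm z)"
      proof (rule order_trans[OF sum_abs sum_mono], unfold abs_mult, rule mult_mono)
        fix i :: 'n
        have "\<bar>partial i g x - partial i g (x + t *\<^sub>R z)\<bar> \<le> N * norm (x - (x + t *\<^sub>R z)) powr (\<theta> - 1)"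
        proof (rule holder_seminorm_leD)
          show "holder_seminorm (\<theta> - 1) (ball 0 4) (partial i g) \<le> ennreal N"
            using N 3 by (intro holder0_norm_leD(2) holder1_norm_leD(2)) (simp add: theta_norm_def)
        qed (use N S seg t in auto)
        also have "\<dots> \<le> N * norm z powr (\<theta> - 1)"
          using N t 3 by (intro mult_left_mono powr_mono2) (auto intro: mult_left_le_one_le)
        finally show "\<bar>partial i g x - partial i g (x + t *\<^sub>R z)\<bar> \<le> N * norm z powr (\<theta> - 1)" .
      qed (use N in \<open>auto simp: component_le_norm_cart\<close>)
      also have "\<dots> = CARD('n) * N * norm z powr \<theta>"
        using powr_mult_base[of "norm z" "\<theta> - 1"] by (simp add: mult_ac)
      also have "\<dots> \<le> (2 + CARD('n)) * N * norm z powr \<theta>"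
        using N by (intro mult_right_mono) auto
      finally show "\<bar>g x - g y + (\<chi> i. partial i g x) \<bullet> (y - x)\<bar> \<le> (2 + CARD('n)) * N * norm (x - y) powr \<theta>"
        by (simp add: z_def norm_minus_commute)
    qed (use 3 in simp)
  qed
qed

section \<open>Principal values of truncated functions\<close>

text \<open>The point reflection is affine with factor -1 in every coordinate, hence preserves
  Lebesgue measure.\<close>

lemma lebesgue_integral_reflect:
  fixes h :: "'a::euclidean_space \<Rightarrow> real"
  assumes [measurable]: "h \<in> borel_measurable lebesgue"
  shows "(LINT y|lebesgue. h (c - y)) = (LINT y|lebesgue. h y)"
proof -
  let ?T = "\<lambda>y :: 'a. c + (\<Sum>j\<in>Basis. (- 1 * (y \<bullet> j)) *\<^sub>R j)"
  have T: "?T = (\<lambda>y. c - y)"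
    by (simp add: sum_negf euclidean_representation)
  have leb: "lebesgue = distr lebesgue lebesgue (\<lambda>y :: 'a. c - y)"
    using lebesgue_affine_euclidean[of "\<lambda>_. - 1" c] unfolding T by (simp add: density_1)
  have [measurable]: "(\<lambda>y :: 'a. c - y) \<in> lebesgue \<rightarrow>\<^sub>M lebesgue"
    using lebesgue_affine_measurable[of "\<lambda>_. - 1" c] unfolding T by simp
  have "(LINT y|lebesgue. h y) = (LINT y|distr lebesgue lebesgue (\<lambda>y. c - y). h y)"
    using leb by simp
  also have "\<dots> = (LINT y|lebesgue. h (c - y))"
    by (rule integral_distr) measurable
  finally show ?thesis ..
qed

text \<open>Off the ball the weight is at least d = min (\<epsilon> powr \<theta>) 1 > 0, so the
  kernel is dominated by 1/d times the weighted kernel.\<close>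

lemma set_integrable_kernel_off_diagonal:
  fixes k :: "'a::euclidean_space \<Rightarrow> real"
  assumes "0 \<le> \<theta>" and [measurable]: "k \<in> borel_measurable lebesgue"
    and kint: "integrable lebesgue (\<lambda>y. min (norm (x - y) powr \<theta>) 1 * \<bar>k y\<bar>)"
    and "0 < \<epsilon>"
  shows "set_integrable lebesgue (- ball x \<epsilon>) k"
  unfolding set_integrable_def
proof (rule Bochner_Integration.integrable_bound)
  have [measurable]: "ball a r \<in> sets lebesgue" for a :: "'a" and r by simp
  define d where "d = min (\<epsilon> powr \<theta>) 1"
  have d: "0 < d" using assms by (simp add: d_def)
  show "integrable lebesgue (\<lambda>y. (1 / d) * (min (norm (x - y) powr \<theta>) 1 * \<bar>k y\<bar>))"
    by (intro integrable_mult_right kint)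
  show "AE y in lebesgue. norm (indicat_real (- ball x \<epsilon>) y *\<^sub>R k y)
      \<le> norm ((1 / d) * (min (norm (x - y) powr \<theta>) 1 * \<bar>k y\<bar>))"
  proof (rule AE_I2)
    fix y
    show "norm (indicat_real (- ball x \<epsilon>) y *\<^sub>R k y) \<le> norm ((1 / d) * (min (norm (x - y) powr \<theta>) 1 * \<bar>k y\<bar>))"
    proof (cases "y \<in> ball x \<epsilon>")
      case False
      then have "\<epsilon> powr \<theta> \<le> norm (x - y) powr \<theta>"
        using assms by (intro powr_mono2) (auto simp: dist_norm)
      then have "d \<le> min (norm (x - y) powr \<theta>) 1" unfolding d_def by linarith
      then have "d * \<bar>k y\<bar> \<le> min (norm (x - y) powr \<theta>) 1 * \<bar>k y\<bar>" by (rule mult_right_mono) simp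
      with False d show ?thesis by (simp add: abs_mult field_simps)
    qed simp
  qed
  show "(\<lambda>y. indicat_real (- ball x \<epsilon>) y *\<^sub>R k y) \<in> borel_measurable lebesgue"
    by measurable
qed

text \<open>Reflection through x preserves the annulus and k but changes the sign of the linear
  factor, so the integral equals its own negative. A non-integrable integrand is covered too, as its
  Bochner integral is 0.\<close>

lemma set_integral_annulus_odd:
  fixes k :: "'a::euclidean_space \<Rightarrow> real"
  assumes [measurable]: "k \<in> borel_measurable lebesgue"
    and sym: "\<And>z. z \<in> ball 0 1 \<Longrightarrow> k (x + z) = k (x - z)"
  shows "(LINT y:(ball x 1 - ball x \<epsilon>)|lebesgue. (p \<bullet> (y - x)) * k y) = 0"
proof -
  have [measurable]: "ball a r \<in> sets lebesgue" for a :: "'a" and r by simp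
  have "(\<lambda>y. p \<bullet> (y - x)) \<in> borel_measurable borel" by simp
  then have [measurable]: "(\<lambda>y. p \<bullet> (y - x)) \<in> borel_measurable lebesgue" by (intro measurable_completion) simp
  define h where "h y = indicat_real (ball x 1 - ball x \<epsilon>) y * ((p \<bullet> (y - x)) * k y)" for y
  have [measurable]: "h \<in> borel_measurable lebesgue"
    unfolding h_def[abs_def] by measurable
  have "h (2 *\<^sub>R x - y) = - h y" for y
  proof -
    have "dist x (2 *\<^sub>R x - y) = dist x y"
      by (simp add: dist_norm scaleR_2 norm_minus_commute)
    moreover have "k (2 *\<^sub>R x - y) = k y" if "dist x y < 1"
      using sym[of "x - y"] that by (simp add: dist_norm norm_minus_commute scaleR_2 add_diff_eq)
    moreover have "p \<bullet> (2 *\<^sub>R x - y - x) = - (p \<bullet> (y - x))"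
      by (simp add: scaleR_2 inner_diff_right)
    ultimately show ?thesis by (auto simp: h_def indicator_def)
  qed
  then have "(LINT y|lebesgue. h y) = - (LINT y|lebesgue. h y)"
    using lebesgue_integral_reflect[of h "2 *\<^sub>R x"] by simp
  then show ?thesis by (simp add: set_lebesgue_integral_def h_def)
qed

text \<open>The removed balls shrink to the null set {x}, and |G| dominates.\<close>

lemma set_integral_compl_ball_tendsto:
  fixes G :: "'a::euclidean_space \<Rightarrow> real"
  assumes G: "integrable lebesgue G"
  shows "((\<lambda>\<epsilon>. LINT y:(- ball x \<epsilon>)|lebesgue. G y) \<longlongrightarrow> (LINT y|lebesgue. G y)) (at_right 0)"
proof (rule tendsto_at_right_sequentially[of 0 1])
  fix S :: "nat \<Rightarrow> real" assume S: "S \<longlonglongrightarrow> 0" "\<And>n. 0 < S n"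
  have [measurable]: "ball a r \<in> sets lebesgue" for a :: "'a" and r by simp
  have [measurable]: "G \<in> borel_measurable lebesgue" using G by simp
  show "(\<lambda>n. LINT y:(- ball x (S n))|lebesgue. G y) \<longlonglongrightarrow> (LINT y|lebesgue. G y)"
    unfolding set_lebesgue_integral_def
  proof (rule integral_dominated_convergence[where w = "\<lambda>y. \<bar>G y\<bar>"])
    have "AE y in lebesgue. y \<noteq> x"
      by (rule AE_I'[of "{x}"]) auto
    then show "AE y in lebesgue. (\<lambda>n. indicat_real (- ball x (S n)) y *\<^sub>R G y) \<longlonglongrightarrow> G y"
    proof eventually_elim
      case (elim y)
      then have "\<forall>\<^sub>F n in sequentially. S n < dist x y"
        using S(1) by (intro order_tendstoD) auto
      then have "\<forall>\<^sub>F n in sequentially. G y = indicat_real (- ball x (S n)) y *\<^sub>R G y"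
        by eventually_elim auto
      then show ?case by (rule Lim_transform_eventually[OF tendsto_const])
    qed
    show "(\<lambda>y. indicat_real (- ball x (S n)) y *\<^sub>R G y) \<in> borel_measurable lebesgue" for n
      by measurable
  qed (use G in \<open>auto simp: indicator_def\<close>)
qed simp

text \<open>The integrand \<open>\<phi>\<close> equals an integrable G minus the odd term h on
  \<open>B\<^sub>1(x)\<close>. The parts of G are G1 on \<open>B\<^sub>1(x)\<close>, where adding h
  makes the Taylor bound applicable, G2 on the annular region up to \<open>B\<^sub>R\<close>, and G3
  outside \<open>B\<^sub>R\<close>, where the truncation is 0 and only w x K remains. By oddness of
  h the principal value is the integral of G. Removing G2 leaves G1, bounded by M times the weighted
  kernel, and G3, bounded by |w x| times it.\<close>

lemma principal_value:
  fixes K :: "real^'n::finite \<Rightarrow> real^'n \<Rightarrow> real"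
  assumes \<theta>: "0 \<le> \<theta>" and k[measurable]: "K x \<in> borel_measurable lebesgue"
    and kint: "integrable lebesgue (\<lambda>y. min (norm (x - y) powr \<theta>) 1 * \<bar>K x y\<bar>)"
    and w[measurable]: "w \<in> borel_measurable lebesgue"
    and R: "ball x 1 \<subseteq> ball 0 R"
    and wk: "set_integrable lebesgue (ball 0 R - ball x 1) (\<lambda>y. w y * K x y)"
    and taylor: "\<And>y. y \<in> ball x 1 \<Longrightarrow> \<bar>w x - w y + p \<bullet> (y - x)\<bar> \<le> M * norm (x - y) powr \<theta>"
    and sym: "p = 0 \<or> (\<forall>z\<in>ball 0 1. K x (x + z) = K x (x - z))"
  obtains l where "has_A_value K (cutoff R w) x l"
    "\<bar>l - (LINT y:(ball 0 R - ball x 1)|lebesgue. (w x - w y) * K x y)\<bar>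
       \<le> (M + \<bar>w x\<bar>) * (LINT y|lebesgue. min (norm (x - y) powr \<theta>) 1 * \<bar>K x y\<bar>)"
proof -
  let ?\<kappa> = "\<lambda>y. min (norm (x - y) powr \<theta>) 1 * \<bar>K x y\<bar>"
  define \<phi> where "\<phi> y = (cutoff R w x - cutoff R w y) * K x y" for y
  define h where "h y = (p \<bullet> (y - x)) * K x y" for y
  define G1 where "G1 y = indicat_real (ball x 1) y * ((w x - w y) * K x y + h y)" for y
  define G2 where "G2 y = indicat_real (ball 0 R - ball x 1) y *\<^sub>R ((w x - w y) * K x y)" for y
  define G3 where "G3 y = indicat_real (- ball 0 R) y *\<^sub>R (w x * K x y)" for y
  define G where "G y = G1 y + G2 y + G3 y" for y
  have [measurable]: "ball a r \<in> sets lebesgue" for a :: "real^'n" and r by simp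
  have "(\<lambda>y. p \<bullet> (y - x)) \<in> borel_measurable borel" by simp
  then have [measurable]: "(\<lambda>y. p \<bullet> (y - x)) \<in> borel_measurable lebesgue" by (intro measurable_completion) simp
  have [measurable]: "\<phi> \<in> borel_measurable lebesgue" "h \<in> borel_measurable lebesgue"
      "G1 \<in> borel_measurable lebesgue" "G2 \<in> borel_measurable lebesgue"
      "G3 \<in> borel_measurable lebesgue"
    unfolding \<phi>_def[abs_def] h_def[abs_def] G1_def[abs_def] G2_def[abs_def] G3_def[abs_def] cutoff_def
    by measurable
  note K_off = set_integrable_kernel_off_diagonal[OF \<theta> k kint]
  have xR: "x \<in> ball 0 R" by (rule subsetD[OF R]) simp
  have G1_bound: "\<bar>G1 y\<bar> \<le> M * ?\<kappa> y" if "y \<in> ball x 1" for y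
  proof -
    have "norm (x - y) powr \<theta> \<le> 1"
      using that \<theta> by (intro powr_le1) (auto simp: dist_norm)
    moreover have "\<bar>G1 y\<bar> = \<bar>w x - w y + p \<bullet> (y - x)\<bar> * \<bar>K x y\<bar>"
      using that by (simp add: G1_def h_def abs_mult distrib_right flip: abs_mult)
    ultimately show ?thesis
      using mult_right_mono[OF taylor[OF that], of "\<bar>K x y\<bar>"] by (simp add: min_absorb1 mult.assoc)
  qed
  have G1_int: "integrable lebesgue G1"
  proof (rule Bochner_Integration.integrable_bound)
    show "integrable lebesgue (\<lambda>y. M * ?\<kappa> y)" by (intro integrable_mult_right kint)
    show "AE y in lebesgue. norm (G1 y) \<le> norm (M * ?\<kappa> y)"
    proof (rule AE_I2)
      fix y show "norm (G1 y) \<le> norm (M * ?\<kappa> y)"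
      proof (cases "y \<in> ball x 1")
        case True
        show ?thesis unfolding real_norm_def by (rule order_trans[OF G1_bound[OF True] abs_ge_self])
      qed (simp add: G1_def)
    qed
  qed measurable
  have "set_integrable lebesgue (ball 0 R - ball x 1) (\<lambda>y. w x * K x y - w y * K x y)"
    using K_off[of 1] by (intro set_integral_diff wk set_integrable_mult_right) (auto intro: set_integrable_subset)
  then have G2_int: "integrable lebesgue G2"
    by (simp add: set_integrable_def G2_def[abs_def] left_diff_distrib)
  have "set_integrable lebesgue (- ball 0 R) (\<lambda>y. w x * K x y)"
    using set_integrable_subset[OF K_off[of 1], of "- ball 0 R"] R
    by (intro set_integrable_mult_right) auto
  then have G3_int: "integrable lebesgue G3"
    by (simp add: set_integrable_def G3_def[abs_def])
  have G_int: "integrable lebesgue G"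
    unfolding G_def[abs_def] by (intro Bochner_Integration.integrable_add G1_int G2_int G3_int)
  have \<phi>G: "\<phi> y = G y - indicat_real (ball x 1) y * h y" for y
    using R xR by (auto simp: \<phi>_def G_def G1_def G2_def G3_def cutoff_def indicator_def)
  \<comment> \<open>Near x the term h may fail to be integrable. Away from x it is dominated by |p|
    |K|, since |y - x| < 1.\<close>
  have h_off: "set_integrable lebesgue (ball x 1 - ball x \<epsilon>) h" if "0 < \<epsilon>" for \<epsilon>
  proof (rule set_integrable_bound)
    show "set_integrable lebesgue (ball x 1 - ball x \<epsilon>) (\<lambda>y. norm p * K x y)"
      using set_integrable_subset[OF K_off[OF that], of "ball x 1 - ball x \<epsilon>"]
      by (intro set_integrable_mult_right) auto
    show "AE y in lebesgue. y \<in> ball x 1 - ball x \<epsilon> \<longrightarrow> norm (h y) \<le> norm (norm p * K x y)"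
    proof (rule AE_I2, rule impI)
      fix y assume y: "y \<in> ball x 1 - ball x \<epsilon>"
      have "\<bar>p \<bullet> (y - x)\<bar> \<le> norm p * norm (y - x)" by (rule Cauchy_Schwarz_ineq2)
      also have "\<dots> \<le> norm p * 1"
        using y by (intro mult_left_mono) (auto simp: dist_norm norm_minus_commute)
      finally show "norm (h y) \<le> norm (norm p * K x y)"
        by (simp add: h_def abs_mult mult_right_mono)
    qed
  qed (simp add: set_borel_measurable_def)
  have G_off: "set_integrable lebesgue (- ball x \<epsilon>) G" for \<epsilon>
    unfolding set_integrable_def by (intro integrable_mult_indicator G_int) simp
  have h_ind: "indicat_real (- ball x \<epsilon>) y *\<^sub>R (indicat_real (ball x 1) y * h y)
      = indicat_real (ball x 1 - ball x \<epsilon>) y *\<^sub>R h y" for \<epsilon> y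
    by (auto simp: indicator_def)
  have ind_off: "set_integrable lebesgue (- ball x \<epsilon>) (\<lambda>y. indicat_real (ball x 1) y * h y)" if "0 < \<epsilon>" for \<epsilon>
    using h_off[OF that] by (simp only: set_integrable_def h_ind)
  have "has_A_value K (cutoff R w) x (LINT y|lebesgue. G y)"
    unfolding has_A_value_def \<phi>_def[symmetric]
  proof (intro conjI allI impI)
    show "set_integrable lebesgue (- ball x \<epsilon>) \<phi>" if "\<epsilon> > 0" for \<epsilon>
      unfolding \<phi>G[abs_def] by (intro set_integral_diff G_off ind_off that)
    \<comment> \<open>For every \<epsilon> the odd term integrates to 0 over the annulus, by
      symmetry of the kernel or because p = 0. The principal value of \<open>\<phi>\<close> is
      therefore the ordinary limit for G.\<close>
    have "(LINT y:(- ball x \<epsilon>)|lebesgue. \<phi> y) = (LINT y:(- ball x \<epsilon>)|lebesgue. G y)" if "0 < \<epsilon>" for \<epsilon>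
    proof -
      have "(LINT y:(- ball x \<epsilon>)|lebesgue. indicat_real (ball x 1) y * h y)
          = (LINT y:(ball x 1 - ball x \<epsilon>)|lebesgue. h y)"
        by (simp only: set_lebesgue_integral_def h_ind)
      also have "\<dots> = 0"
        using sym set_integral_annulus_odd[OF k] by (auto simp: h_def)
      finally show ?thesis
        unfolding \<phi>G by (subst set_integral_diff(2)[OF G_off ind_off[OF that]]) simp
    qed
    then have "\<forall>\<^sub>F \<epsilon> in at_right 0.
        (LINT y:(- ball x \<epsilon>)|lebesgue. G y) = (LINT y:(- ball x \<epsilon>)|lebesgue. \<phi> y)"
      by (auto simp: eventually_at_filter)
    then show "((\<lambda>\<epsilon>. LINT y:(- ball x \<epsilon>)|lebesgue. \<phi> y) \<longlongrightarrow> (LINT y|lebesgue. G y)) (at_right 0)"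
      by (rule Lim_transform_eventually[OF set_integral_compl_ball_tendsto[OF G_int]])
  qed
  moreover have "\<bar>(LINT y|lebesgue. G y) - (LINT y:(ball 0 R - ball x 1)|lebesgue. (w x - w y) * K x y)\<bar>
       \<le> (M + \<bar>w x\<bar>) * (LINT y|lebesgue. ?\<kappa> y)"
  proof -
    have "(LINT y|lebesgue. G y) = (LINT y|lebesgue. G1 y + G3 y) + (LINT y|lebesgue. G2 y)"
      unfolding G_def using G1_int G2_int G3_int by simp
    then have "\<bar>(LINT y|lebesgue. G y) - (LINT y:(ball 0 R - ball x 1)|lebesgue. (w x - w y) * K x y)\<bar>
        = \<bar>LINT y|lebesgue. G1 y + G3 y\<bar>"
      by (simp add: G2_def set_lebesgue_integral_def)
    also have "\<dots> \<le> (LINT y|lebesgue. (M + \<bar>w x\<bar>) * ?\<kappa> y)"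
    proof (rule integral_abs_bound_integral)
      \<comment> \<open>The sign of M is read off from the Taylor bound at some z \<noteq> x in
        \<open>B\<^sub>1(x)\<close>. At y = x the weight is 0 by the convention for
        \<open>powr\<close>.\<close>
      have M: "0 \<le> M * ?\<kappa> y" for y
      proof (cases "y = x")
        case False
        obtain z where z: "z \<in> ball x 1" "z \<noteq> x"
        proof
          show "x + (1/2) *\<^sub>R axis undefined 1 \<in> ball x 1" by (simp add: dist_norm)
          show "x + (1/2) *\<^sub>R axis undefined 1 \<noteq> x" by simp
        qed
        have "0 \<le> M * norm (x - z) powr \<theta>" using taylor[OF z(1)] by linarith
        then have "0 \<le> M" using z by (simp add: zero_le_mult_iff)
        then show ?thesis by simp
      qed simp
      show "\<bar>G1 y + G3 y\<bar> \<le> (M + \<bar>w x\<bar>) * ?\<kappa> y" for y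
      proof (cases "y \<in> ball x 1")
        case True
        then have "G3 y = 0" using R by (auto simp: G3_def)
        with G1_bound[OF True] show ?thesis by (simp add: distrib_right add_increasing2)
      next
        case False
        then have "1 \<le> norm (x - y) powr \<theta>"
          using \<theta> by (intro ge_one_powr_ge_zero) (auto simp: dist_norm)
        then have "?\<kappa> y = \<bar>K x y\<bar>" by (simp add: min_absorb2)
        moreover have "G1 y = 0" using False by (simp add: G1_def)
        moreover have "\<bar>G3 y\<bar> \<le> \<bar>w x\<bar> * \<bar>K x y\<bar>" by (simp add: G3_def indicator_def abs_mult)
        ultimately have "\<bar>G1 y + G3 y\<bar> \<le> \<bar>w x\<bar> * ?\<kappa> y" by (simp only: add_0_left)
        with M[of y] show ?thesis unfolding distrib_right by (rule add_increasing)
      qed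
    qed (use G1_int G3_int kint in auto)
    finally show ?thesis by simp
  qed
  ultimately show thesis by (rule that)
qed

section \<open>Principal values for kernels in \<open>K_class\<close> and functions in
  \<open>C_theta_K\<close>\<close>

lemma C_theta_continuous:
  assumes "u \<in> C_theta \<theta>"
  shows "continuous_on (ball 0 4) u"
proof (cases "1 < \<theta>")
  case True
  with assms have "\<forall>x\<in>ball 0 4. u differentiable (at x)" by (simp add: C_theta_def)
  then show ?thesis
    by (simp add: continuous_at_imp_continuous_on differentiable_imp_continuous_within)
qed (use assms in \<open>simp add: C_theta_def\<close>)

lemma K_class_integrable:
  assumes "K \<in> K_class m \<theta>" "x \<in> ball 0 1"
  shows "integrable lebesgue (\<lambda>y. min (norm (x - y) powr \<theta>) 1 * \<bar>K x y\<bar>)"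
proof (rule integrableI_bounded)
  have [measurable]: "K x \<in> borel_measurable lebesgue" using assms by (simp add: K_class_def)
  have "(\<lambda>y. norm (x - y)) \<in> borel_measurable borel" by simp
  then have [measurable]: "(\<lambda>y. norm (x - y)) \<in> borel_measurable lebesgue"
    by (intro measurable_completion) simp
  show "(\<lambda>y. min (norm (x - y) powr \<theta>) 1 * \<bar>K x y\<bar>) \<in> borel_measurable lebesgue"
    by measurable
  show "(\<integral>\<^sup>+y. ennreal (norm (min (norm (x - y) powr \<theta>) 1 * \<bar>K x y\<bar>)) \<partial>lebesgue) < \<infinity>"
    using assms by (simp add: K_class_def abs_mult)
qed

lemma mpartial_zero: "mpartial (\<lambda>_. 0) g = g"
proof -
  have "foldr (\<lambda>i. partial i ^^ 0) is g = g" for "is" :: "'a list"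
    by (induction "is") auto
  then show ?thesis by (simp add: mpartial_def)
qed

text \<open>The kernel itself is its derivative for the multi-index 0. For m > 0 this is one summand
  of the first condition in \<open>C_theta_K\<close>; for m = 0 that sum is empty and the supremum
  condition, then of order 0, gives the bound.\<close>

lemma C_theta_K_far_integral:
  assumes u: "u \<in> C_theta_K m \<theta> K" and x: "x \<in> ball 0 1" and R: "3 < R"
  shows "(\<integral>\<^sup>+y\<in>ball 0 R - ball 0 3. ennreal (\<bar>u y\<bar> * \<bar>K x y\<bar>) \<partial>lebesgue) < \<infinity>"
proof (cases "m = 0")
  case True
  have "(\<integral>\<^sup>+y\<in>ball 0 R - ball 0 3. ennreal (\<bar>u y\<bar> * \<bar>K x y\<bar>) \<partial>lebesgue)
      \<le> (\<integral>\<^sup>+y\<in>- ball 0 3. ennreal \<bar>u y\<bar> * sup_partials m K y \<partial>lebesgue)"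
  proof (rule nn_integral_mono)
    fix y
    have "ennreal \<bar>mpartial (\<lambda>_. 0) (\<lambda>x. K x y) x\<bar> \<le> sup_partials m K y"
      unfolding sup_partials_def
      by (rule SUP_upper2[of "\<lambda>_. 0"], simp add: mi_deg_def True, rule SUP_upper2[OF x]) simp
    then show "ennreal (\<bar>u y\<bar> * \<bar>K x y\<bar>) * indicator (ball 0 R - ball 0 3) y
        \<le> ennreal \<bar>u y\<bar> * sup_partials m K y * indicator (- ball 0 3) y"
      by (auto simp: indicator_def ennreal_mult mpartial_zero intro: mult_left_mono)
  qed
  also have "\<dots> < \<infinity>" using u by (simp add: C_theta_K_def)
  finally show ?thesis .
next
  case False
  let ?J = "\<lambda>\<alpha>. \<integral>\<^sup>+y\<in>ball 0 R - ball 0 3. ennreal (\<bar>u y\<bar> * \<bar>mpartial \<alpha> (\<lambda>x. K x y) x\<bar>) \<partial>lebesgue"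
  have "(\<integral>\<^sup>+y\<in>ball 0 R - ball 0 3. ennreal (\<bar>u y\<bar> * \<bar>K x y\<bar>) \<partial>lebesgue) = ?J (\<lambda>_. 0)"
    by (simp add: mpartial_zero)
  also have "\<dots> \<le> (\<Sum>\<alpha> | mi_deg \<alpha> < m. ?J \<alpha>)"
    using False by (intro member_le_sum finite_mi_deg_less) (auto simp: mi_deg_def)
  also have "\<dots> < \<infinity>" using u x R by (simp add: C_theta_K_def)
  finally show ?thesis .
qed

text \<open>The region is split at \<open>B\<^sub>3\<close>. Inside, u is bounded by its norm on
  \<open>B\<^sub>4\<close> and the kernel is integrable off the diagonal; outside, the conditions on
  derivatives of the kernel apply.\<close>

lemma C_theta_K_integrable_off_diagonal:
  assumes \<theta>: "0 \<le> \<theta>" and K: "K \<in> K_class m \<theta>" and u: "u \<in> C_theta_K m \<theta> K"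
    and x: "x \<in> ball 0 1" and R: "3 < R"
  shows "set_integrable lebesgue (ball 0 R - ball x 1) (\<lambda>y. u y * K x y)"
proof -
  have [measurable]: "ball a r \<in> sets lebesgue" for a :: "real^'a" and r by simp
  have [measurable]: "K x \<in> borel_measurable lebesgue" using K x by (simp add: K_class_def)
  have uC: "u \<in> C_theta \<theta>" using u by (simp add: C_theta_K_def)
  then have [measurable]: "u \<in> borel_measurable lebesgue" by (simp add: C_theta_def L1_loc_def)
  define N where "N = enn2real (theta_norm \<theta> u)"
  have N: "theta_norm \<theta> u \<le> ennreal N" "0 \<le> N"
    using uC by (simp_all add: N_def C_theta_def)
  have xy: "dist x y < 1 \<Longrightarrow> norm y < 3" for y
    using x norm_triangle_ineq2[of y x] by (simp add: dist_norm norm_minus_commute)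
  have "set_integrable lebesgue (ball 0 3 - ball x 1) (\<lambda>y. u y * K x y)"
  proof (rule set_integrable_bound)
    show "set_integrable lebesgue (ball 0 3 - ball x 1) (\<lambda>y. N * K x y)"
      by (intro set_integrable_mult_right set_integrable_subset[OF
            set_integrable_kernel_off_diagonal[OF \<theta> _ K_class_integrable[OF K x] zero_less_one]]) auto
    show "AE y in lebesgue. y \<in> ball 0 3 - ball x 1 \<longrightarrow> norm (u y * K x y) \<le> norm (N * K x y)"
      using theta_norm_leD[OF N C_theta_continuous[OF uC]] N
      by (intro AE_I2 impI) (auto simp: abs_mult intro!: mult_right_mono)
  qed (simp add: set_borel_measurable_def)
  moreover have "set_integrable lebesgue (ball 0 R - ball 0 3) (\<lambda>y. u y * K x y)"
    unfolding set_integrable_def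
  proof (rule integrableI_bounded)
    have "(\<integral>\<^sup>+y. ennreal (norm (indicat_real (ball 0 R - ball 0 3) y *\<^sub>R (u y * K x y))) \<partial>lebesgue)
        = (\<integral>\<^sup>+y\<in>ball 0 R - ball 0 3. ennreal (\<bar>u y\<bar> * \<bar>K x y\<bar>) \<partial>lebesgue)"
      by (intro nn_integral_cong) (simp add: indicator_def abs_mult)
    also have "\<dots> < \<infinity>" by (rule C_theta_K_far_integral[OF u x R])
    finally show "(\<integral>\<^sup>+y. ennreal (norm (indicat_real (ball 0 R - ball 0 3) y *\<^sub>R (u y * K x y))) \<partial>lebesgue) < \<infinity>" .
    show "(\<lambda>y. indicat_real (ball 0 R - ball 0 3) y *\<^sub>R (u y * K x y)) \<in> borel_measurable lebesgue"
      by measurable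
  qed
  ultimately have "set_integrable lebesgue ((ball 0 3 - ball x 1) \<union> (ball 0 R - ball 0 3)) (\<lambda>y. u y * K x y)"
    by (rule set_integrable_Un) auto
  also have "(ball 0 3 - ball x 1) \<union> (ball 0 R - ball 0 3) = ball 0 R - ball x 1"
    using R xy by fastforce
  finally show ?thesis .
qed

text \<open>The assumptions on w are listed separately so that both u and the difference of
  \<open>us k\<close> and u can be inserted. The factor \<open>3 + CARD('n)\<close> is the Taylor
  constant plus 1, the latter from |w x| \<le> N.\<close>

lemma principal_value_le_theta_norm:
  fixes K :: "real^'n::finite \<Rightarrow> real^'n \<Rightarrow> real" and N :: real
  assumes \<theta>: "0 \<le> \<theta>" "\<theta> \<le> 2" and K: "K \<in> K_class m \<theta>" and x: "x \<in> ball 0 1" and R: "3 < R"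
    and w: "w \<in> borel_measurable lebesgue" "continuous_on (ball 0 4) w"
      "\<And>y. 1 < \<theta> \<Longrightarrow> y \<in> ball 0 4 \<Longrightarrow> w differentiable (at y)"
    and N: "theta_norm \<theta> w \<le> ennreal N" "0 \<le> N"
    and wK: "set_integrable lebesgue (ball 0 R - ball x 1) (\<lambda>y. w y * K x y)"
  obtains l where "has_A_value K (cutoff R w) x l"
    "\<bar>l - (LINT y:(ball 0 R - ball x 1)|lebesgue. (w x - w y) * K x y)\<bar>
       \<le> (3 + CARD('n)) * N * (LINT y|lebesgue. min (norm (x - y) powr \<theta>) 1 * \<bar>K x y\<bar>)"
proof -
  let ?\<kappa> = "LINT y|lebesgue. min (norm (x - y) powr \<theta>) 1 * \<bar>K x y\<bar>"
  have x4: "x \<in> ball 0 4" using x by simp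
  have B: "ball x 1 \<subseteq> ball 0 2"
  proof
    fix y assume "y \<in> ball x 1"
    then show "y \<in> ball 0 2"
      using x norm_triangle_ineq2[of y x] by (simp add: dist_norm norm_minus_commute)
  qed
  obtain p where p: "p = 0 \<or> 1 < \<theta>" and taylor: "\<And>y. y \<in> ball 0 4 \<Longrightarrow>
       \<bar>w x - w y + p \<bullet> (y - x)\<bar> \<le> (2 + CARD('n)) * N * norm (x - y) powr \<theta>"
    using theta_norm_taylor[OF \<theta> N w(2,3) x4] by metis
  obtain l where l: "has_A_value K (cutoff R w) x l"
    "\<bar>l - (LINT y:(ball 0 R - ball x 1)|lebesgue. (w x - w y) * K x y)\<bar>
       \<le> ((2 + CARD('n)) * N + \<bar>w x\<bar>) * ?\<kappa>"
  proof (rule principal_value[where K = K and x = x and w = w and R = R, OF \<theta>(1) _ K_class_integrable[OF K x] w(1) _ wK])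
    show "K x \<in> borel_measurable lebesgue" using K x by (simp add: K_class_def)
    show "ball x 1 \<subseteq> ball 0 R" using order_trans[OF B subset_ball] R by simp
    show "p = 0 \<or> (\<forall>z\<in>ball 0 1. K x (x + z) = K x (x - z))" using p K x by (auto simp: K_class_def)
    show "\<bar>w x - w y + p \<bullet> (y - x)\<bar> \<le> (2 + CARD('n)) * N * norm (x - y) powr \<theta>" if "y \<in> ball x 1" for y
      using taylor[of y] subsetD[OF B that] by simp
  qed
  note l(2)
  also have "((2 + CARD('n)) * N + \<bar>w x\<bar>) * ?\<kappa> \<le> (3 + CARD('n)) * N * ?\<kappa>"
    using theta_norm_leD[OF N w(2) x4] by (intro mult_right_mono integral_nonneg_AE) (auto simp: algebra_simps)
  finally show thesis using l(1) that by simp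
qed

section \<open>Convergence in k of the principal values, uniformly in the truncation radius\<close>

lemma has_A_value_diff:
  assumes "has_A_value K (cutoff R u) x a" "has_A_value K (cutoff R v) x b"
  shows "has_A_value K (cutoff R (\<lambda>y. u y - v y)) x (a - b)"
proof -
  have eq: "(cutoff R (\<lambda>y. u y - v y) x - cutoff R (\<lambda>y. u y - v y) y) * K x y =
      (cutoff R u x - cutoff R u y) * K x y - (cutoff R v x - cutoff R v y) * K x y" for y
    by (simp add: cutoff_def algebra_simps)
  note int = assms[unfolded has_A_value_def, THEN conjunct1, rule_format]
  have "((\<lambda>\<epsilon>. (LINT y:(- ball x \<epsilon>)|lebesgue. (cutoff R u x - cutoff R u y) * K x y)
      - (LINT y:(- ball x \<epsilon>)|lebesgue. (cutoff R v x - cutoff R v y) * K x y)) \<longlongrightarrow> a - b) (at_right 0)"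
    using assms unfolding has_A_value_def by (intro tendsto_diff) auto
  moreover have "\<forall>\<^sub>F \<epsilon> in at_right 0. (LINT y:(- ball x \<epsilon>)|lebesgue. (cutoff R u x - cutoff R u y) * K x y)
      - (LINT y:(- ball x \<epsilon>)|lebesgue. (cutoff R v x - cutoff R v y) * K x y) =
      (LINT y:(- ball x \<epsilon>)|lebesgue. (cutoff R (\<lambda>y. u y - v y) x - cutoff R (\<lambda>y. u y - v y) y) * K x y)"
    unfolding eq by (auto simp: eventually_at_filter int set_integral_diff(2))
  ultimately have "((\<lambda>\<epsilon>. LINT y:(- ball x \<epsilon>)|lebesgue. (cutoff R (\<lambda>y. u y - v y) x - cutoff R (\<lambda>y. u y - v y) y) * K x y)
      \<longlongrightarrow> a - b) (at_right 0)"
    by (rule Lim_transform_eventually)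
  then show ?thesis
    unfolding has_A_value_def eq by (auto intro!: set_integral_diff(1) int)
qed

lemma has_A_value_unique:
  "has_A_value K u x a \<Longrightarrow> has_A_value K u x b \<Longrightarrow> a = b"
  unfolding has_A_value_def by (auto intro: tendsto_unique[OF trivial_limit_at_right_real])

lemma uniform_limit_sum:
  fixes f :: "'c \<Rightarrow> 'd \<Rightarrow> 'a \<Rightarrow> 'b::real_normed_vector"
  assumes "\<And>a. a \<in> X \<Longrightarrow> uniform_limit S (f a) (g a) F"
  shows "uniform_limit S (\<lambda>k y. \<Sum>a\<in>X. f a k y) (\<lambda>y. \<Sum>a\<in>X. g a y) F"
  using assms
  by (induction X rule: infinite_finite_induct) (auto intro: uniform_limit_const uniform_limit_add)

text \<open>Off \<open>B\<^sub>1(x)\<close> the weight is 1, and for R \<le> 4 both w x and w y are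
  at most N in absolute value. This handles the radii in (3, 4], for which the convergence
  hypothesis on the annular integrals says nothing.\<close>

lemma annulus_integral_le:
  fixes K :: "real^'n::finite \<Rightarrow> real^'n \<Rightarrow> real" and N :: real
  assumes \<theta>: "0 \<le> \<theta>" and K: "K \<in> K_class m \<theta>" and x: "x \<in> ball 0 1" and R: "R \<le> 4"
    and w: "\<And>y. y \<in> ball 0 4 \<Longrightarrow> \<bar>w y\<bar> \<le> N"
    and wK: "set_integrable lebesgue (ball 0 R - ball x 1) (\<lambda>y. w y * K x y)"
  shows "\<bar>LINT y:(ball 0 R - ball x 1)|lebesgue. (w x - w y) * K x y\<bar>
    \<le> 2 * N * (LINT y|lebesgue. min (norm (x - y) powr \<theta>) 1 * \<bar>K x y\<bar>)"
proof -
  let ?\<kappa> = "\<lambda>y. min (norm (x - y) powr \<theta>) 1 * \<bar>K x y\<bar>"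
  have K_off: "set_integrable lebesgue (- ball x 1) (K x)"
    using K x K_class_integrable[OF K x]
    by (intro set_integrable_kernel_off_diagonal[OF \<theta>]) (auto simp: K_class_def)
  have int: "set_integrable lebesgue (ball 0 R - ball x 1) (\<lambda>y. w x * K x y - w y * K x y)"
    by (intro set_integral_diff wK set_integrable_mult_right set_integrable_subset[OF K_off]) auto
  have N: "0 \<le> N" using w[of x] x by simp
  have "\<bar>LINT y|lebesgue. indicat_real (ball 0 R - ball x 1) y *\<^sub>R ((w x - w y) * K x y)\<bar>
      \<le> (LINT y|lebesgue. 2 * N * ?\<kappa> y)"
  proof (rule integral_abs_bound_integral)
    show "integrable lebesgue (\<lambda>y. indicat_real (ball 0 R - ball x 1) y *\<^sub>R ((w x - w y) * K x y))"
      using int by (simp add: set_integrable_def left_diff_distrib)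
    show "integrable lebesgue (\<lambda>y. 2 * N * ?\<kappa> y)"
      by (intro integrable_mult_right K_class_integrable[OF K x])
    show "\<bar>indicat_real (ball 0 R - ball x 1) y *\<^sub>R ((w x - w y) * K x y)\<bar> \<le> 2 * N * ?\<kappa> y" for y
    proof (cases "y \<in> ball 0 R - ball x 1")
      case True
      then have "1 \<le> norm (x - y) powr \<theta>"
        using \<theta> by (intro ge_one_powr_ge_zero) (auto simp: dist_norm)
      then have \<kappa>: "?\<kappa> y = \<bar>K x y\<bar>" by (simp add: min_absorb2)
      have "\<bar>w x - w y\<bar> \<le> 2 * N" using w[of x] w[of y] x R True by simp
      then show ?thesis unfolding \<kappa> using True by (simp add: abs_mult mult_right_mono)
    qed (use N in simp)
  qed
  then show ?thesis by (simp add: set_lebesgue_integral_def)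
qed

text \<open>By linearity gs k R - g R is the principal value for w = us k - u. It is compared with
  the integral over \<open>B\<^sub>R - B\<^sub>1(x)\<close>, and both the error and that integral
  have bounds independent of R.\<close>

lemma A_value_uniform_limit:
  fixes K :: "real^'n::finite \<Rightarrow> real^'n \<Rightarrow> real"
  assumes \<theta>: "0 \<le> \<theta>" "\<theta> \<le> 2" and K: "K \<in> K_class m \<theta>" and x: "x \<in> ball 0 1"
    and us: "\<And>k. k \<ge> 1 \<Longrightarrow> us k \<in> C_theta_K m \<theta> K" and u: "u \<in> C_theta_K m \<theta> K"
    and norm_lim: "(\<lambda>k. theta_norm \<theta> (\<lambda>x. us k x - u x)) \<longlonglongrightarrow> 0"
    and sup_lim: "(\<lambda>k. SUP x\<in>ball 0 1. SUP R\<in>{4<..}.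
            ennreal \<bar>LINT y:(ball 0 R - ball x 1)|lebesgue.
                      ((u x - us k x) - (u y - us k y)) * K x y\<bar>) \<longlonglongrightarrow> 0"
    and g: "\<And>R. R > 3 \<Longrightarrow> has_A_value K (cutoff R u) x (g R)"
    and gs: "\<And>k R. k \<ge> 1 \<Longrightarrow> R > 3 \<Longrightarrow> has_A_value K (cutoff R (us k)) x (gs k R)"
  shows "uniform_limit {3<..} gs g sequentially"
proof -
  define N where "N k = enn2real (theta_norm \<theta> (\<lambda>x. us k x - u x))" for k
  define S where "S k = (SUP x\<in>ball 0 1. SUP R\<in>{4<..}.
            ennreal \<bar>LINT y:(ball 0 R - ball x 1)|lebesgue.
                      ((u x - us k x) - (u y - us k y)) * K x y\<bar>)" for k
  define s where "s k = enn2real (S k)" for k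
  define \<kappa> where "\<kappa> = (LINT y|lebesgue. min (norm (x - y) powr \<theta>) 1 * \<bar>K x y\<bar>)"
  \<comment> \<open>The first summand bounds the distance from the principal value to the annular
    integral. The bracket bounds that integral itself: s k for R > 4 and the term with N k for R
    \<le> 4, added to avoid a dependence on R.\<close>
  define e where "e k = (3 + CARD('n)) * N k * \<kappa> + (s k + 2 * N k * \<kappa>)" for k
  have S0: "S \<longlonglongrightarrow> 0" using sup_lim by (simp add: S_def[abs_def])
  have N0: "N \<longlonglongrightarrow> 0" using tendsto_enn2real[of _ 0] norm_lim by (simp add: N_def[abs_def])
  have s0: "s \<longlonglongrightarrow> 0" using tendsto_enn2real[of _ 0] S0 by (simp add: s_def[abs_def])
  have "e \<longlonglongrightarrow> (3 + CARD('n)) * (0 :: real) * \<kappa> + (0 + 2 * 0 * \<kappa>)"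
    unfolding e_def by (intro tendsto_intros N0 s0)
  then have e0: "e \<longlonglongrightarrow> 0" by simp
  have \<kappa>0: "0 \<le> \<kappa>" unfolding \<kappa>_def by (intro integral_nonneg_AE) auto
  \<comment> \<open>\<open>enn2real\<close> sends infinity to 0, so N k and s k are genuine bounds
    only once the norms and suprema are finite; convergence to 0 ensures this for large k.\<close>
  have "\<forall>\<^sub>F k in sequentially. theta_norm \<theta> (\<lambda>x. us k x - u x) < \<infinity> \<and> S k < \<infinity> \<and> 1 \<le> k"
    using norm_lim S0 by (intro eventually_conj order_tendstoD(2) eventually_ge_at_top) auto
  then have bound: "\<forall>\<^sub>F k in sequentially. \<forall>R\<in>{3<..}. \<bar>gs k R - g R\<bar> \<le> e k"
  proof eventually_elim
    case (elim k)
    define w where "w y = us k y - u y" for y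
    have k: "1 \<le> k" using elim by simp
    have C: "us k \<in> C_theta \<theta>" "u \<in> C_theta \<theta>" using us[OF k] u by (auto simp: C_theta_K_def)
    have wm: "w \<in> borel_measurable lebesgue"
      using C by (auto simp: w_def[abs_def] C_theta_def L1_loc_def)
    have wc: "continuous_on (ball 0 4) w"
      unfolding w_def using C by (intro continuous_intros C_theta_continuous)
    have wd: "w differentiable (at y)" if "1 < \<theta>" "y \<in> ball 0 4" for y
      unfolding w_def using C that by (intro differentiable_diff) (auto simp: C_theta_def)
    have N: "theta_norm \<theta> w \<le> ennreal (N k)" "0 \<le> N k"
      using elim by (simp_all add: N_def w_def[abs_def])
    show ?case
    proof
      fix R :: real assume "R \<in> {3<..}"
      then have R: "3 < R" by simp
      note int = C_theta_K_integrable_off_diagonal[OF \<theta>(1) K _ x R]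
      have wK: "set_integrable lebesgue (ball 0 R - ball x 1) (\<lambda>y. w y * K x y)"
        using set_integral_diff(1)[OF int[OF us[OF k]] int[OF u]] by (simp add: w_def left_diff_distrib)
      let ?I = "LINT y:(ball 0 R - ball x 1)|lebesgue. (w x - w y) * K x y"
      obtain l where l: "has_A_value K (cutoff R w) x l" "\<bar>l - ?I\<bar> \<le> (3 + CARD('n)) * N k * \<kappa>"
        by (rule principal_value_le_theta_norm[OF \<theta> K x R wm wc wd N wK, folded \<kappa>_def])
      have "w = (\<lambda>y. us k y - u y)" by (simp add: w_def[abs_def])
      then have "has_A_value K (cutoff R w) x (gs k R - g R)"
        by (simp only:) (rule has_A_value_diff[OF gs[OF k R] g[OF R]])
      then have l_eq: "l = gs k R - g R" using l(1) by (rule has_A_value_unique[rotated])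
      have I_le: "\<bar>?I\<bar> \<le> s k + 2 * N k * \<kappa>"
      proof (cases "R \<le> 4")
        case True
        have "\<bar>?I\<bar> \<le> 2 * N k * \<kappa>"
          unfolding \<kappa>_def by (rule annulus_integral_le[OF \<theta>(1) K x True theta_norm_leD[OF N wc] wK])
        then show ?thesis by (simp add: s_def add_increasing)
      next
        case False
        let ?J = "LINT y:(ball 0 R - ball x 1)|lebesgue. ((u x - us k x) - (u y - us k y)) * K x y"
        have "?J = - ?I"
          unfolding set_lebesgue_integral_def
          by (subst Bochner_Integration.integral_minus[symmetric], rule Bochner_Integration.integral_cong)
            (auto simp: w_def algebra_simps)
        moreover have "ennreal \<bar>?J\<bar> \<le> S k"
          unfolding S_def using False by (intro SUP_upper2[OF x] SUP_upper2[of R]) auto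
        then have "\<bar>?J\<bar> \<le> s k"
          using elim by (cases "S k") (auto simp: s_def)
        ultimately show ?thesis using N \<kappa>0 by (simp add: add_increasing2)
      qed
      have "\<bar>gs k R - g R\<bar> \<le> \<bar>l - ?I\<bar> + \<bar>?I\<bar>" unfolding l_eq by linarith
      also have "\<dots> \<le> e k"
        unfolding e_def by (rule add_mono[OF l(2) I_le])
      finally show "\<bar>gs k R - g R\<bar> \<le> e k" .
    qed
  qed
  show ?thesis
  proof (rule uniform_limitI)
    fix \<epsilon> :: real assume "0 < \<epsilon>"
    then have "\<forall>\<^sub>F k in sequentially. e k < \<epsilon>" by (rule order_tendstoD[OF e0])
    with bound show "\<forall>\<^sub>F k in sequentially. \<forall>R\<in>{3<..}. dist (gs k R) (g R) < \<epsilon>"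
    proof eventually_elim
      case (elim k)
      show ?case
      proof
        fix R :: real assume "R \<in> {3<..}"
        with elim(1) have "\<bar>gs k R - g R\<bar> \<le> e k" by (rule bspec)
        also have "\<dots> < \<epsilon>" by (rule elim(2))
        finally show "dist (gs k R) (g R) < \<epsilon>" unfolding dist_real_def .
      qed
    qed
  qed
qed

lemma A_value_exists:
  fixes K :: "real^'n::finite \<Rightarrow> real^'n \<Rightarrow> real"
  assumes \<theta>: "0 \<le> \<theta>" "\<theta> \<le> 2" and K: "K \<in> K_class m \<theta>" and x: "x \<in> ball 0 1"
    and u: "u \<in> C_theta_K m \<theta> K" and R: "3 < R"
  shows "\<exists>l. has_A_value K (cutoff R u) x l"
proof -
  have C: "u \<in> C_theta \<theta>" using u by (simp add: C_theta_K_def)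
  then have "u \<in> borel_measurable lebesgue" "theta_norm \<theta> u \<le> ennreal (enn2real (theta_norm \<theta> u))"
    "\<And>y. 1 < \<theta> \<Longrightarrow> y \<in> ball 0 4 \<Longrightarrow> u differentiable (at y)"
    by (auto simp: C_theta_def L1_loc_def)
  then show ?thesis
    using principal_value_le_theta_norm[OF \<theta> K x R _ C_theta_continuous[OF C] _ _ _
        C_theta_K_integrable_off_diagonal[OF \<theta>(1) K u x R]] by (metis enn2real_nonneg)
qed

section \<open>Exchange of the limits in k and R\<close>

theorem proposition2p11:
  fixes m :: nat and \<theta> :: real
    and K :: "real^'n::finite \<Rightarrow> real^'n \<Rightarrow> real"
    and us :: "nat \<Rightarrow> real^'n \<Rightarrow> real" and fs :: "nat \<Rightarrow> real^'n \<Rightarrow> real"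
    and u :: "real^'n \<Rightarrow> real" and f :: "real^'n \<Rightarrow> real"
  assumes "0 \<le> \<theta>" and "\<theta> \<le> 2"
    and "K \<in> K_class m \<theta>"
    and "\<And>k. k \<ge> 1 \<Longrightarrow> us k \<in> C_theta_K m \<theta> K"
    and "\<And>k. k \<ge> 1 \<Longrightarrow> continuous_on (ball 0 1) (fs k) \<and> bounded (fs k ` ball 0 1)"
    and "u \<in> C_theta_K m \<theta> K"
    and "\<And>k. k \<ge> 1 \<Longrightarrow> A_eq_mod m K (us k) (fs k)"
    and "uniform_limit (ball 0 1) fs f sequentially"
    and "(\<lambda>k. theta_norm \<theta> (\<lambda>x. us k x - u x)) \<longlonglongrightarrow> 0"
    and "(\<lambda>k. SUP x\<in>ball 0 1. SUP R\<in>{4<..}.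
            ennreal \<bar>LINT y:(ball 0 R - ball x 1)|lebesgue.
                      ((u x - us k x) - (u y - us k y)) * K x y\<bar>) \<longlonglongrightarrow> 0"
    and "((\<lambda>R. SUP k\<in>{1..}. \<integral>\<^sup>+y\<in>- ball 0 R. ennreal \<bar>us k y\<bar> * sup_partials m K y \<partial>lebesgue)
            \<longlongrightarrow> 0) at_top"
  shows "A_eq_mod m K u f"
proof -
  let ?B = "ball 0 1 :: (real^'n) set"
  have fs: "\<forall>\<^sub>F k in sequentially. continuous_on ?B (fs k)" "\<forall>\<^sub>F k in sequentially. bounded (fs k ` ?B)"
    using assms(5) by (auto intro: eventually_sequentiallyI)
  define g where "g R x = (SOME l. has_A_value K (cutoff R u) x l)" for R x
  have g: "has_A_value K (cutoff R u) x (g R x)" if "3 < R" "x \<in> ?B" for R x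
    unfolding g_def by (rule someI_ex) (rule A_value_exists[OF assms(1-3) that(2) assms(6) that(1)])
  \<comment> \<open>The premise 1 \<le> k sits inside the existential so that choice can range over
    all natural numbers.\<close>
  have "\<forall>k. \<exists>P F. 1 \<le> k \<longrightarrow>
        (\<forall>R>3. poly_deg_less m (P R) \<and> F R \<in> borel_measurable (lebesgue_on ?B) \<and>
               (\<forall>x\<in>?B. has_A_value K (cutoff R (us k)) x (F R x + P R x))) \<and>
        (\<forall>x\<in>?B. ((\<lambda>R. F R x) \<longlongrightarrow> fs k x) at_top)"
    using assms(7) unfolding A_eq_mod_def by blast
  from choice[OF this] obtain P where "\<forall>k. \<exists>F. 1 \<le> k \<longrightarrow>
        (\<forall>R>3. poly_deg_less m (P k R) \<and> F R \<in> borel_measurable (lebesgue_on ?B) \<and>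
               (\<forall>x\<in>?B. has_A_value K (cutoff R (us k)) x (F R x + P k R x))) \<and>
        (\<forall>x\<in>?B. ((\<lambda>R. F R x) \<longlongrightarrow> fs k x) at_top)" by blast
  from choice[OF this] obtain F where PF: "\<And>k. 1 \<le> k \<Longrightarrow>
        (\<forall>R>3. poly_deg_less m (P k R) \<and> F k R \<in> borel_measurable (lebesgue_on ?B) \<and>
               (\<forall>x\<in>?B. has_A_value K (cutoff R (us k)) x (F k R x + P k R x))) \<and>
        (\<forall>x\<in>?B. ((\<lambda>R. F k R x) \<longlongrightarrow> fs k x) at_top)" by blast
  have P: "poly_deg_less m (P k R)"
    and F: "F k R \<in> borel_measurable (lebesgue_on ?B)"
    and FP: "\<And>x. x \<in> ?B \<Longrightarrow> has_A_value K (cutoff R (us k)) x (F k R x + P k R x)"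
    if "1 \<le> k" "3 < R" for k R
    using PF[OF that(1)] that(2) by blast+
  have F_lim: "((\<lambda>R. F k R x) \<longlongrightarrow> fs k x) at_top" if "1 \<le> k" "x \<in> ?B" for k x
    using PF[OF that(1)] that(2) by blast
  have unif: "uniform_limit {3<..} (\<lambda>k R. F k R x + P k R x) (\<lambda>R. g R x) sequentially" if "x \<in> ?B" for x
    by (rule A_value_uniform_limit[OF assms(1-3) that assms(4,6,9,10) g[OF _ that] FP[OF _ _ that]])
  obtain X L where X: "finite X" "X \<subseteq> ?B" and L: "\<And>a. a \<in> X \<Longrightarrow> poly_deg_less m (L a)"
    and rep: "\<And>p x. poly_deg_less m p \<Longrightarrow> x \<in> ?B \<Longrightarrow> p x = (\<Sum>a\<in>X. p a * L a x)"
    using poly_deg_less_interpolation by metis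
  \<comment> \<open>Q R interpolates g R - f at the nodes. If g R = F + p with p of degree less than
    m, then p cancels and g R - Q R is F minus the interpolant of F - f, which tends to f whenever F
    does.\<close>
  define Q where "Q R x = (\<Sum>a\<in>X. (g R a - f a) * L a x)" for R x
  have Q: "poly_deg_less m (Q R)" for R
    unfolding Q_def using X(1) L by (rule poly_deg_less_sum)
  \<comment> \<open>Each g R is a pointwise limit of measurable functions; the index is shifted by
    \<open>Suc\<close> because nothing is known at k = 0.\<close>
  have g_meas: "g R \<in> borel_measurable (lebesgue_on ?B)" if R: "3 < R" for R
  proof (rule borel_measurable_LIMSEQ_real)
    show "(\<lambda>k. F (Suc k) R x + P (Suc k) R x) \<longlonglongrightarrow> g R x" if "x \<in> space (lebesgue_on ?B)" for x
      using tendsto_uniform_limitI[OF unif, of x R] that R by (intro LIMSEQ_Suc) simp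
    show "(\<lambda>x. F (Suc k) R x + P (Suc k) R x) \<in> borel_measurable (lebesgue_on ?B)" for k
      using borel_measurable_add[OF F[of "Suc k" R] poly_deg_less_measurable[OF P[of "Suc k" R]]] R by simp
  qed
  have "((\<lambda>R. g R x - Q R x) \<longlongrightarrow> f x) at_top" if x: "x \<in> ?B" for x
  proof (rule swap_uniform_limit')
    \<comment> \<open>This is g R x - Q R x with u and f replaced by \<open>us k\<close> and
      \<open>fs k\<close>. Only x and the finitely many nodes enter, so pointwise convergence
      uniform in R at these points is enough to let k tend to infinity.\<close>
    let ?h = "\<lambda>k R. (F k R x + P k R x) - (\<Sum>a\<in>X. ((F k R a + P k R a) - fs k a) * L a x)"
    have f_unif: "uniform_limit {3<..} (\<lambda>k R. fs k a) (\<lambda>R. f a) sequentially" if "a \<in> ?B" for a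
      using tendsto_uniform_limitI[OF assms(8) that] by (auto simp: uniform_limit_iff tendsto_iff)
    show "uniform_limit {3<..} ?h (\<lambda>R. g R x - Q R x) sequentially"
      unfolding Q_def using X(2) x
      by (intro uniform_limit_minus uniform_limit_sum unif f_unif
          bounded_linear.uniform_limit[OF bounded_linear_mult_left]) auto
    \<comment> \<open>The polynomial P k R equals its own interpolant and drops out, so for fixed k
      only F k R has to be followed as R tends to infinity; the interpolation correction then tends
      to 0.\<close>
    have h: "?h k R = F k R x - (\<Sum>a\<in>X. (F k R a - fs k a) * L a x)" if "1 \<le> k" "3 < R" for k R
      using rep[OF P[OF that] x] by (simp add: algebra_simps sum.distrib sum_subtractf)
    have "(?h k \<longlongrightarrow> fs k x) at_top" if k: "1 \<le> k" for k
    proof -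
      have "((\<lambda>R. F k R x - (\<Sum>a\<in>X. (F k R a - fs k a) * L a x))
          \<longlongrightarrow> fs k x - (\<Sum>a\<in>X. (fs k a - fs k a) * L a x)) at_top"
        using X(2) x by (intro tendsto_intros F_lim k) auto
      moreover have "\<forall>\<^sub>F R in at_top. F k R x - (\<Sum>a\<in>X. (F k R a - fs k a) * L a x) = ?h k R"
        using eventually_gt_at_top[of 3] by eventually_elim (simp only: h[OF k])
      ultimately show ?thesis by (simp add: tendsto_cong)
    qed
    then show "\<forall>\<^sub>F k in sequentially. (?h k \<longlongrightarrow> fs k x) at_top"
      by (auto intro: eventually_sequentiallyI)
    show "(\<lambda>k. fs k x) \<longlonglongrightarrow> f x" by (rule tendsto_uniform_limitI[OF assms(8) x])
    show "\<forall>\<^sub>F R in at_top. R \<in> {3::real<..}" using eventually_gt_at_top[of 3] by simp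
  qed simp
  moreover have "(\<lambda>x. g R x - Q R x) \<in> borel_measurable (lebesgue_on ?B)" if "3 < R" for R
    by (intro borel_measurable_diff g_meas that poly_deg_less_measurable[OF Q])
  moreover have "continuous_on ?B f"
    by (rule uniform_limit_theorem[OF fs(1) assms(8)]) simp
  moreover have "bounded (f ` ?B)"
    by (rule uniform_limit_bounded[OF assms(8) fs(2)]) simp
  ultimately show ?thesis
    unfolding A_eq_mod_def
    by (intro conjI exI[of _ Q] exI[of _ "\<lambda>R x. g R x - Q R x"]) (auto simp: Q g)
qed

end
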